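(* The variety $\Sigma(3,2,3,5)$ has codimension $1$ in $G(3,S_2)$. (Here $N_1=N_2=21$.)
   Context: For positive integers $n,d,r,s$: let $V$ be a $\mathbb C$-vector space of dimension $n+1$ and $S_d=\mathrm{Sym}^d V$ (degree $d$ forms in $x_0,\dots,x_n$); assume $r\le s\le\dim S_d$. $G(r,S_d)$ is the Grassmannian of $r$-dimensional subspaces of $S_d$. $U_s\subseteq \mathrm{Sym}^s(\mathbb P S_1)$ is the open set of unordered $s$-tuples $\{Q_1,\dots,Q_s\}$ of linear forms (up to scalars) with $Q_1^d,\dots,Q_s^d$ linearly independent over $\mathbb C$. $\Sigma=\Sigma(n,d,r,s)\subseteq G(r,S_d)$ is the (constructible) set of all $\Lambda$ such that $\Lambda\subseteq \mathrm{span}(Q_1^d,\dots,Q_s^d)$ for some $\{Q_1,\dots,Q_s\}\in U_s$. Also $N_1=sn+r(s-r)$ and $N_2=\dim G(r,S_d)=r\left(\binom{n+d}{d}-r\right)$. In the present statement $(n,d,r,s)=(3,2,3,5)$. *)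

theory Defs
  imports
    "HOL-Library.Poly_Mapping"
    "HOL-Library.Extended_Nat"
    "HOL-Analysis.Abstract_Topology"
    "Jordan_Normal_Form.Determinant"
begin

section \<open>Polynomials and forms\<close>

text \<open>
  A monomial in variables of type \<open>'v\<close> is a finitely supported exponent map, and a polynomial is
  a finitely supported family of complex coefficients indexed by monomials; \<open>Poly_Mapping\<close>
  provides the usual (convolution) ring structure.
\<close>

type_synonym 'v monom = "'v \<Rightarrow>\<^sub>0 nat"
type_synonym 'v cpoly = "'v monom \<Rightarrow>\<^sub>0 complex"

definition mdegree :: "'v monom \<Rightarrow> nat" where
  "mdegree m = (\<Sum>i\<in>Poly_Mapping.keys m. Poly_Mapping.lookup m i)"

definition monoms :: "'v set \<Rightarrow> nat \<Rightarrow> 'v monom set" where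
  "monoms I d = {m. Poly_Mapping.keys m \<subseteq> I \<and> mdegree m = d}"

definition forms :: "'v set \<Rightarrow> nat \<Rightarrow> 'v cpoly set" where
  "forms I d = {p. Poly_Mapping.keys p \<subseteq> monoms I d}"

definition eval_poly :: "'v cpoly \<Rightarrow> ('v \<Rightarrow> complex) \<Rightarrow> complex" where
  "eval_poly p x =
     (\<Sum>m\<in>Poly_Mapping.keys p. Poly_Mapping.lookup p m *
        (\<Prod>i\<in>Poly_Mapping.keys m. x i ^ Poly_Mapping.lookup m i))"

definition scale_poly :: "complex \<Rightarrow> 'v cpoly \<Rightarrow> 'v cpoly" where
  "scale_poly c p = Poly_Mapping.single 0 c * p"

interpretation cpoly: vector_space "scale_poly :: complex \<Rightarrow> 'v cpoly \<Rightarrow> 'v cpoly"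
proof unfold_locales
  fix a b :: complex and x y :: "'v cpoly"
  show "scale_poly a (x + y) = scale_poly a x + scale_poly a y"
    by (simp add: scale_poly_def distrib_left)
  show "scale_poly (a + b) x = scale_poly a x + scale_poly b x"
    by (simp add: scale_poly_def single_add distrib_right)
  show "scale_poly a (scale_poly b x) = scale_poly (a * b) x"
    by (simp add: scale_poly_def mult_single flip: mult.assoc)
  show "scale_poly 1 x = x"
    by (simp add: scale_poly_def)
qed

text \<open>\<open>Sd n d\<close> is \<open>S_d = Sym^d V\<close> for \<open>V\<close> with basis \<open>x_0, \<dots>, x_n\<close>.\<close>

definition Sd :: "nat \<Rightarrow> nat \<Rightarrow> nat cpoly set" where
  "Sd n d = forms {..n} d"


section \<open>The Grassmannian and its Zariski topology\<close>

definition Grass :: "nat \<Rightarrow> nat \<Rightarrow> nat \<Rightarrow> nat cpoly set set" where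
  "Grass n d r = {\<Lambda>. cpoly.subspace \<Lambda> \<and> \<Lambda> \<subseteq> Sd n d \<and> cpoly.dim \<Lambda> = r}"

definition ordered_basis :: "nat cpoly list \<Rightarrow> nat cpoly set \<Rightarrow> bool" where
  "ordered_basis bs \<Lambda> \<longleftrightarrow>
     distinct bs \<and> cpoly.independent (set bs) \<and> cpoly.span (set bs) = \<Lambda>"

text \<open>
  The Pluecker coordinates of the subspace with ordered basis \<open>bs\<close> are the maximal minors of its
  coefficient matrix. They are indexed redundantly, by all \<open>r\<close>-tuples of monomials of degree \<open>d\<close>
  rather than by increasing ones. This embeds the Grassmannian in the projective space of
  \<open>r\<close>-fold tensors, which contains that of the exterior power as a linear subspace, so the
  induced topology is the same.
\<close>

definition pluecker_index :: "nat \<Rightarrow> nat \<Rightarrow> nat \<Rightarrow> nat monom list set" where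
  "pluecker_index n d r = {ms. length ms = r \<and> set ms \<subseteq> monoms {..n} d}"

definition pluecker :: "nat cpoly list \<Rightarrow> nat monom list \<Rightarrow> complex" where
  "pluecker bs ms =
     det (mat (length bs) (length bs) (\<lambda>(i, j). Poly_Mapping.lookup (bs ! i) (ms ! j)))"

text \<open>
  The locus where a homogeneous polynomial \<open>F\<close> in the Pluecker coordinates does not vanish.
  Changing the basis of \<open>\<Lambda>\<close> rescales all its coordinates by one nonzero factor, so the condition
  does not depend on the basis chosen.
\<close>

definition nonvanishing ::
    "nat \<Rightarrow> nat \<Rightarrow> nat \<Rightarrow> nat monom list cpoly \<Rightarrow> nat cpoly set set" where
  "nonvanishing n d r F =
     {\<Lambda> \<in> Grass n d r. \<exists>bs. ordered_basis bs \<Lambda> \<and> eval_poly F (pluecker bs) \<noteq> 0}"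

definition zariski_Grass :: "nat \<Rightarrow> nat \<Rightarrow> nat \<Rightarrow> nat cpoly set topology" where
  "zariski_Grass n d r =
     topology_generated_by
       {nonvanishing n d r F | F k. F \<in> forms (pluecker_index n d r) k}"


section \<open>Codimension\<close>

definition irreducible_closed :: "'a topology \<Rightarrow> 'a set \<Rightarrow> bool" where
  "irreducible_closed X Z \<longleftrightarrow>
     closedin X Z \<and> Z \<noteq> {} \<and>
     (\<forall>A B. closedin X A \<and> closedin X B \<and> Z = A \<union> B \<longrightarrow> Z = A \<or> Z = B)"

definition irreducible_chain :: "'a topology \<Rightarrow> 'a set \<Rightarrow> nat \<Rightarrow> (nat \<Rightarrow> 'a set) \<Rightarrow> bool" where
  "irreducible_chain X Z k C \<longleftrightarrow>
     C 0 = Z \<and> (\<forall>i\<le>k. irreducible_closed X (C i)) \<and> (\<forall>i<k. C i \<subset> C (Suc i))"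

text \<open>
  The codimension of an irreducible closed subset \<open>Z\<close> is the supremum of the lengths of chains of
  irreducible closed subsets \<open>Z = C 0 \<subset> \<dots> \<subset> C k\<close>; that of an arbitrary closed subset \<open>Y\<close> is the
  infimum over the irreducible closed subsets of \<open>Y\<close>.
\<close>

definition irreducible_codim :: "'a topology \<Rightarrow> 'a set \<Rightarrow> enat" where
  "irreducible_codim X Z = (SUP k\<in>{k. \<exists>C. irreducible_chain X Z k C}. enat k)"

definition codim :: "'a topology \<Rightarrow> 'a set \<Rightarrow> enat" where
  "codim X Y = (INF Z\<in>{Z. irreducible_closed X Z \<and> Z \<subseteq> Y}. irreducible_codim X Z)"


section \<open>The variety of subspaces spanned by powers\<close>

text \<open>
  A point of \<open>U_s\<close> is given by a set of representatives \<open>Q_1, \<dots>, Q_s\<close> of its \<open>s\<close> points of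
  \<open>P S_1\<close>. Both the independence of the \<open>Q_i^d\<close> and their span are unchanged when the \<open>Q_i\<close> are
  rescaled. Injectivity of \<open>d\<close>-th powers on the set makes the independence that of the family
  and not merely of the set of powers.
\<close>

definition Us :: "nat \<Rightarrow> nat \<Rightarrow> nat \<Rightarrow> nat cpoly set set" where
  "Us n d s =
     {Q. Q \<subseteq> Sd n 1 \<and> finite Q \<and> card Q = s \<and>
         inj_on (\<lambda>q. q ^ d) Q \<and> cpoly.independent ((\<lambda>q. q ^ d) ` Q)}"

definition Sigma_var :: "nat \<Rightarrow> nat \<Rightarrow> nat \<Rightarrow> nat \<Rightarrow> nat cpoly set set" where
  "Sigma_var n d r s =
     {\<Lambda> \<in> Grass n d r. \<exists>Q\<in>Us n d s. \<Lambda> \<subseteq> cpoly.span ((\<lambda>q. q ^ d) ` Q)}"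

definition N1 :: "nat \<Rightarrow> nat \<Rightarrow> nat \<Rightarrow> nat" where
  "N1 n r s = s * n + r * (s - r)"

definition N2 :: "nat \<Rightarrow> nat \<Rightarrow> nat \<Rightarrow> nat" where
  "N2 n d r = r * (((n + d) choose d) - r)"

end

theory Submission
  imports Defs "HOL-Analysis.Brouwer_Fixpoint" "HOL-Analysis.Finite_Cartesian_Product"
begin

text \<open>
  A net of quadrics in four variables is a tensor in \<open>\<complex>\<^sup>3 \<otimes> Sym\<^sup>2 \<complex>\<^sup>4\<close>, and the nets in \<open>\<Sigma>\<close> are
  sums of five terms \<open>v \<otimes> q\<^sup>2\<close>. The Koszul flattening of such a tensor is a \<open>12 \<times> 12\<close> matrix,
  to which each term contributes rank at most 2, so its determinant vanishes on \<open>\<Sigma>\<close>. It does not vanish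
  identically, hence the closure of \<open>\<Sigma>\<close> is a proper subset of the irreducible Grassmannian.

  Conversely, the derivative of the parametrization \<open>(v, q) \<mapsto> \<Sum> v \<otimes> q\<^sup>2\<close> at an explicit point shows
  that in an affine chart of dimension 21 the projection of \<open>\<Sigma>\<close> to 20 of the coordinates is
  dominant. By pseudo-division with respect to the remaining coordinate, nothing irreducible lies
  strictly between an irreducible closed set with this property and the whole chart.
\<close>

text \<open>Since \<open>N1 = N2\<close>, counting parameters predicts that \<Sigma> is dense. The
  count fails because the fibres of the parametrization have positive dimension: five general points
  of P^2 x P^3 lie on a rational curve of bidegree (2, 3), which O(1, 2) embeds as a rational normal
  curve of degree 8, and a general point of its span P^8 lies on a one-parameter family of 5-secant
  4-planes. The determinant exhibits this defect as an equation. Its block pattern is, up to sign,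
  the cross product with the triple of Gram matrices, so \<open>v \<otimes> q\<^sup>2\<close> gives
  the Kronecker product of a cross product matrix (rank at most 2) with \<open>q q^T\<close> (rank
  at most 1). In the other direction, codimension is defined by chains of closed sets, so the rank
  of a derivative has to be turned into a statement about irreducible sets; elimination of one
  coordinate does this. Only the closure of the nondegenerate nets is shown to be irreducible:
  \<open>codim\<close> is an infimum, so this one subset bounds it from above, while the bound from
  below treats every irreducible closed subset.\<close>

hide_const (open) Finite_Cartesian_Product.mat Finite_Cartesian_Product.vec

section \<open>Polynomial functions\<close>

text \<open>Polynomials are kept as functions, which loses nothing over an infinite field and makes
  substitution plain composition. The index set records which coordinates may occur; elimination
  later removes one of them.\<close>

inductive_set polyfuns :: "'i set \<Rightarrow> (('i \<Rightarrow> complex) \<Rightarrow> complex) set" for I where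
  const: "(\<lambda>x. c) \<in> polyfuns I"
| var: "i \<in> I \<Longrightarrow> (\<lambda>x. x i) \<in> polyfuns I"
| add: "f \<in> polyfuns I \<Longrightarrow> g \<in> polyfuns I \<Longrightarrow> (\<lambda>x. f x + g x) \<in> polyfuns I"
| mult: "f \<in> polyfuns I \<Longrightarrow> g \<in> polyfuns I \<Longrightarrow> (\<lambda>x. f x * g x) \<in> polyfuns I"

lemma polyfuns_mono: "f \<in> polyfuns I \<Longrightarrow> I \<subseteq> J \<Longrightarrow> f \<in> polyfuns J"
  by (induction rule: polyfuns.induct) (auto intro: polyfuns.intros)

lemma polyfuns_uminus: "f \<in> polyfuns I \<Longrightarrow> (\<lambda>x. - f x) \<in> polyfuns I"
  using polyfuns.mult[OF polyfuns.const[of "-1"], of f I] by simp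

lemma polyfuns_sum:
  "(\<And>a. a \<in> A \<Longrightarrow> f a \<in> polyfuns I) \<Longrightarrow> (\<lambda>x. \<Sum>a\<in>A. f a x) \<in> polyfuns I"
  by (induction A rule: infinite_finite_induct) (auto intro: polyfuns.intros)

lemma polyfuns_prod:
  "(\<And>a. a \<in> A \<Longrightarrow> f a \<in> polyfuns I) \<Longrightarrow> (\<lambda>x. \<Prod>a\<in>A. f a x) \<in> polyfuns I"
  by (induction A rule: infinite_finite_induct) (auto intro: polyfuns.intros)

lemma polyfuns_power: "f \<in> polyfuns I \<Longrightarrow> (\<lambda>x. f x ^ k) \<in> polyfuns I"
  by (induction k) (auto intro: polyfuns.intros)

lemma polyfuns_det:
  assumes "\<And>i j. i < m \<Longrightarrow> j < m \<Longrightarrow> (\<lambda>x. a x i j) \<in> polyfuns I"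
  shows "(\<lambda>x. det (mat m m (\<lambda>(i, j). a x i j))) \<in> polyfuns I"
proof -
  have "det (mat m m (\<lambda>(i, j). a x i j))
    = (\<Sum>p | p permutes {0..<m}. signof p * (\<Prod>i = 0..<m. a x i (p i)))" for x
    unfolding det_def
    by (auto intro!: sum.cong prod.cong simp: permutes_in_image)
  moreover have "(\<lambda>x. \<Sum>p | p permutes {0..<m}. signof p * (\<Prod>i = 0..<m. a x i (p i))) \<in> polyfuns I"
    by (intro polyfuns_sum polyfuns.mult polyfuns.const polyfuns_prod assms)
       (auto simp: permutes_in_image)
  ultimately show ?thesis by simp
qed

lemma polyfuns_comp:
  assumes "f \<in> polyfuns I" "\<And>i. i \<in> I \<Longrightarrow> (\<lambda>x. g x i) \<in> polyfuns J"
  shows "(\<lambda>x. f (g x)) \<in> polyfuns J"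
  using assms by (induction rule: polyfuns.induct) (auto intro: polyfuns.intros)

lemma polyfuns_cong:
  assumes "f \<in> polyfuns I" "\<And>i. i \<in> I \<Longrightarrow> x i = y i"
  shows "f x = f y"
  using assms by (induction rule: polyfuns.induct) auto

lemma polyfuns_line:
  assumes "f \<in> polyfuns I"
  shows "\<exists>p. \<forall>s. poly p s = f (\<lambda>i. a i + s * b i)"
  using assms
proof (induction rule: polyfuns.induct)
  case (const c)
  show ?case by (rule exI[of _ "[:c:]"]) simp
next
  case (var i)
  show ?case by (rule exI[of _ "[:a i, b i:]"]) simp
next
  case (add f g)
  then show ?case by (metis poly_add)
next
  case (mult f g)
  then show ?case by (metis poly_mult)
qed

text \<open>Irreducibility of affine space: on the line through \<open>a\<close> and
  \<open>b\<close> neither restriction is the zero polynomial, and univariate polynomials form a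
  domain.\<close>

lemma polyfuns_mult_nonzero:
  assumes "f \<in> polyfuns I" "g \<in> polyfuns I" "f a \<noteq> 0" "g b \<noteq> 0"
  shows "\<exists>x. f x \<noteq> 0 \<and> g x \<noteq> 0"
proof -
  obtain p where p: "\<And>s. poly p s = f (\<lambda>i. a i + s * (b i - a i))"
    using polyfuns_line[OF assms(1)] by metis
  obtain q where q: "\<And>s. poly q s = g (\<lambda>i. a i + s * (b i - a i))"
    using polyfuns_line[OF assms(2)] by metis
  have "p \<noteq> 0" using p[of 0] assms(3) by auto
  moreover have "q \<noteq> 0" using q[of 1] assms(4) by auto
  ultimately have "p * q \<noteq> 0" by simp
  then obtain s where "poly (p * q) s \<noteq> 0" using poly_all_0_iff_0 by blast
  then show ?thesis using p q by auto
qed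

text \<open>A box that is open in the classical topology is Zariski dense: the segment from
  \<open>a\<close> towards \<open>x\<close> starts inside the box, so the restriction to this line
  has infinitely many roots. This is the bridge from the analytic openness of the parametrization to
  an algebraic statement.\<close>

lemma polyfuns_eq_0_box:
  assumes f: "f \<in> polyfuns I" and fin: "finite I" and e: "e > 0"
    and 0: "\<And>x. (\<And>i. i \<in> I \<Longrightarrow> norm (x i - a i) < e) \<Longrightarrow> f x = 0"
  shows "f x = 0"
proof -
  obtain p where p: "\<And>s. poly p s = f (\<lambda>i. a i + s * (x i - a i))"
    using polyfuns_line[OF f] by metis
  define B where "B = 1 + (\<Sum>i\<in>I. norm (x i - a i))"
  have B: "norm (x i - a i) < B" if "i \<in> I" for i
    unfolding B_def using member_le_sum[OF that, of "\<lambda>i. norm (x i - a i)"] fin by auto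
  have Bp: "B > 0" unfolding B_def by (simp add: add_pos_nonneg sum_nonneg)
  have "poly p (of_real s) = 0" if s: "0 < s" "s < e / B" for s :: real
    unfolding p
  proof (rule 0)
    fix i assume i: "i \<in> I"
    have "norm (of_real s * (x i - a i)) = s * norm (x i - a i)"
      using s by (simp add: norm_mult)
    also have "\<dots> \<le> s * B" using B[OF i] s by simp
    also have "\<dots> < e" using s Bp by (simp add: field_simps)
    finally show "norm (a i + of_real s * (x i - a i) - a i) < e" by simp
  qed
  then have "of_real ` {0<..<e / B} \<subseteq> {s. poly p s = 0}" by auto
  moreover have "infinite (of_real ` {0<..<e / B} :: complex set)"
  proof -
    have "infinite {0<..<e / B}" using e Bp by (intro infinite_Ioo) simp
    moreover have "inj_on (of_real :: real \<Rightarrow> complex) {0<..<e / B}" by (simp add: inj_on_def)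
    ultimately show ?thesis using finite_imageD by blast
  qed
  ultimately have "p = 0" using poly_roots_finite finite_subset by blast
  then show ?thesis using p[of 1] by simp
qed

subsection \<open>Elimination of one coordinate\<close>

text \<open>The bound on the degree in \<open>x t\<close> is strict, so bound 0 leaves only the zero
  function, and the bound of a remainder can equal the degree of the divisor.\<close>

definition polyfuns_below :: "'i set \<Rightarrow> 'i \<Rightarrow> nat \<Rightarrow> (('i \<Rightarrow> complex) \<Rightarrow> complex) set" where
  "polyfuns_below I t d =
     {f. \<exists>c. (\<forall>i. c i \<in> polyfuns (I - {t})) \<and> f = (\<lambda>x. \<Sum>i<d. c i x * x t ^ i)}"

lemma polyfuns_below_0: "f \<in> polyfuns_below I t 0 \<Longrightarrow> f x = 0"
  by (auto simp: polyfuns_below_def)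

lemma polyfuns_below_zero: "(\<lambda>x. 0) \<in> polyfuns_below I t d"
  unfolding polyfuns_below_def mem_Collect_eq
  by (rule exI[of _ "\<lambda>_ _. 0"]) (auto intro: polyfuns.const)

lemma polyfuns_below_Suc:
  assumes "f \<in> polyfuns_below I t d" "b \<in> polyfuns (I - {t})"
  shows "(\<lambda>x. f x + b x * x t ^ d) \<in> polyfuns_below I t (Suc d)"
proof -
  obtain c where c: "\<And>i. c i \<in> polyfuns (I - {t})" "f = (\<lambda>x. \<Sum>i<d. c i x * x t ^ i)"
    using assms(1) by (auto simp: polyfuns_below_def)
  show ?thesis unfolding polyfuns_below_def mem_Collect_eq
    by (rule exI[of _ "c(d := b)"]) (use assms c in auto)
qed

lemma polyfuns_below_SucE:
  assumes "f \<in> polyfuns_below I t (Suc d)"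
  obtains g b where "g \<in> polyfuns_below I t d" "b \<in> polyfuns (I - {t})"
    "f = (\<lambda>x. g x + b x * x t ^ d)"
proof -
  obtain c where c: "\<And>i. c i \<in> polyfuns (I - {t})" "f = (\<lambda>x. \<Sum>i<Suc d. c i x * x t ^ i)"
    using assms by (auto simp: polyfuns_below_def)
  show ?thesis
    by (rule that[of "\<lambda>x. \<Sum>i<d. c i x * x t ^ i" "c d"])
       (use c in \<open>auto simp: polyfuns_below_def\<close>)
qed

lemma polyfuns_below_mono:
  assumes "f \<in> polyfuns_below I t d" "d \<le> e"
  shows "f \<in> polyfuns_below I t e"
  using assms(2,1)
proof (induction rule: dec_induct)
  case (step n)
  then show ?case
    using polyfuns_below_Suc[of f I t n "\<lambda>_. 0"] by (simp add: polyfuns.const)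
qed

lemma polyfuns_below_add:
  assumes "f \<in> polyfuns_below I t d" "g \<in> polyfuns_below I t d"
  shows "(\<lambda>x. f x + g x) \<in> polyfuns_below I t d"
proof -
  obtain c where c: "\<And>i. c i \<in> polyfuns (I - {t})" "f = (\<lambda>x. \<Sum>i<d. c i x * x t ^ i)"
    using assms by (auto simp: polyfuns_below_def)
  obtain c' where c': "\<And>i. c' i \<in> polyfuns (I - {t})" "g = (\<lambda>x. \<Sum>i<d. c' i x * x t ^ i)"
    using assms by (auto simp: polyfuns_below_def)
  show ?thesis unfolding polyfuns_below_def mem_Collect_eq
    by (rule exI[of _ "\<lambda>i x. c i x + c' i x"])
       (auto simp: c c' sum.distrib algebra_simps intro: polyfuns.add)
qed

lemma polyfuns_below_scale:
  assumes "f \<in> polyfuns_below I t d" "b \<in> polyfuns (I - {t})"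
  shows "(\<lambda>x. b x * f x) \<in> polyfuns_below I t d"
proof -
  obtain c where c: "\<And>i. c i \<in> polyfuns (I - {t})" "f = (\<lambda>x. \<Sum>i<d. c i x * x t ^ i)"
    using assms by (auto simp: polyfuns_below_def)
  show ?thesis unfolding polyfuns_below_def mem_Collect_eq
    by (rule exI[of _ "\<lambda>i x. b x * c i x"])
       (auto simp: c assms sum_distrib_left algebra_simps intro: polyfuns.mult)
qed

lemma polyfuns_below_shift:
  assumes "f \<in> polyfuns_below I t d"
  shows "(\<lambda>x. x t ^ k * f x) \<in> polyfuns_below I t (k + d)"
  using assms
proof (induction d arbitrary: f)
  case 0
  then show ?case using polyfuns_below_0[OF 0] polyfuns_below_zero by simp
next
  case (Suc d)
  obtain g b where gb: "g \<in> polyfuns_below I t d" "b \<in> polyfuns (I - {t})"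
    "f = (\<lambda>x. g x + b x * x t ^ d)"
    by (rule polyfuns_below_SucE[OF Suc.prems])
  have "(\<lambda>x. x t ^ k * g x + b x * x t ^ (k + d)) \<in> polyfuns_below I t (Suc (k + d))"
    by (intro polyfuns_below_Suc Suc.IH gb)
  moreover have "(\<lambda>x. x t ^ k * g x + b x * x t ^ (k + d)) = (\<lambda>x. x t ^ k * f x)"
    by (auto simp: gb algebra_simps power_add)
  ultimately show ?case by simp
qed

lemma polyfuns_below_mult:
  assumes "f \<in> polyfuns_below I t d" "g \<in> polyfuns_below I t e"
  shows "(\<lambda>x. f x * g x) \<in> polyfuns_below I t (d + e)"
  using assms(1)
proof (induction d arbitrary: f)
  case 0
  then show ?case using polyfuns_below_0[OF 0] polyfuns_below_zero by simp
next
  case (Suc d)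
  obtain h b where hb: "h \<in> polyfuns_below I t d" "b \<in> polyfuns (I - {t})"
    "f = (\<lambda>x. h x + b x * x t ^ d)"
    by (rule polyfuns_below_SucE[OF Suc.prems])
  have "(\<lambda>x. h x * g x + b x * (x t ^ d * g x)) \<in> polyfuns_below I t (Suc d + e)"
    by (rule polyfuns_below_add[OF polyfuns_below_mono[OF Suc.IH[OF hb(1)]]
          polyfuns_below_scale[OF polyfuns_below_mono[OF polyfuns_below_shift[OF assms(2)]]
            hb(2)]]) auto
  then show ?case by (simp add: hb algebra_simps)
qed

lemma polyfuns_imp_below:
  assumes "f \<in> polyfuns I"
  shows "\<exists>d. f \<in> polyfuns_below I t d"
  using assms
proof (induction rule: polyfuns.induct)
  case (const c)
  have "(\<lambda>x. 0 + c * x t ^ 0) \<in> polyfuns_below I t (Suc 0)"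
    by (intro polyfuns_below_Suc polyfuns_below_zero polyfuns.const)
  then show ?case by auto
next
  case (var i)
  show ?case
  proof (cases "i = t")
    case True
    have "(\<lambda>x. 0 + 1 * x t ^ 1) \<in> polyfuns_below I t (Suc 1)"
      by (intro polyfuns_below_Suc polyfuns_below_zero polyfuns.const)
    then show ?thesis using True by auto
  next
    case False
    have "(\<lambda>x. 0 + x i * x t ^ 0) \<in> polyfuns_below I t (Suc 0)"
      by (intro polyfuns_below_Suc polyfuns_below_zero polyfuns.var) (use var False in auto)
    then show ?thesis by auto
  qed
next
  case (add f g)
  then obtain d e where "f \<in> polyfuns_below I t d" "g \<in> polyfuns_below I t e" by blast
  then have "(\<lambda>x. f x + g x) \<in> polyfuns_below I t (max d e)"
    by (intro polyfuns_below_add) (auto elim: polyfuns_below_mono)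
  then show ?case by blast
next
  case (mult f g)
  then obtain d e where "f \<in> polyfuns_below I t d" "g \<in> polyfuns_below I t e" by blast
  from polyfuns_below_mult[OF this] show ?case by (rule exI)
qed

lemma polyfuns_below_imp:
  assumes "f \<in> polyfuns_below I t d" "t \<in> I"
  shows "f \<in> polyfuns I"
proof -
  obtain c where c: "\<And>i. c i \<in> polyfuns (I - {t})" "f = (\<lambda>x. \<Sum>i<d. c i x * x t ^ i)"
    using assms by (auto simp: polyfuns_below_def)
  show ?thesis unfolding c(2)
    by (intro polyfuns_sum polyfuns.mult polyfuns_power polyfuns.var assms polyfuns_mono[OF c(1)])
      auto
qed

text \<open>The leading coefficient \<open>a\<close> need not be invertible, hence the power of
  \<open>a\<close> on the left. The bound \<open>e - d\<close> on the quotient is smaller than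
  \<open>e\<close> when \<open>d\<close> and \<open>e\<close> are positive; the descent in
  \<open>no_irreducible_between\<close> relies on this.\<close>

lemma polyfuns_pseudo_division:
  assumes f0: "f0 \<in> polyfuns_below I t d" and a: "a \<in> polyfuns (I - {t})"
    and f: "f = (\<lambda>x. f0 x + a x * x t ^ d)" and g: "g \<in> polyfuns_below I t e"
  shows "\<exists>k q r. q \<in> polyfuns_below I t (e - d) \<and> r \<in> polyfuns_below I t d \<and>
           (\<forall>x. a x ^ k * g x = q x * f x + r x)"
  using g
proof (induction e arbitrary: g)
  case 0
  then show ?case using polyfuns_below_0[OF 0] polyfuns_below_zero
    by (intro exI[of _ 0] exI[of _ "\<lambda>_. 0"]) auto
next
  case (Suc e)
  show ?case
  proof (cases "Suc e \<le> d")
    case True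
    then show ?thesis using polyfuns_below_zero polyfuns_below_mono[OF Suc.prems]
      by (intro exI[of _ 0] exI[of _ "\<lambda>_. 0"] exI[of _ g]) auto
  next
    case False
    then have de: "d \<le> e" by simp
    obtain g0 b where gb: "g0 \<in> polyfuns_below I t e" "b \<in> polyfuns (I - {t})"
      "g = (\<lambda>x. g0 x + b x * x t ^ e)"
      by (rule polyfuns_below_SucE[OF Suc.prems])
    \<comment> \<open>This is \<open>a g - b x_t^(e-d) f\<close> with the two leading terms already
      cancelled, so the bound falls to \<open>e\<close>.\<close>
    define g' where "g' = (\<lambda>x. a x * g0 x + (- b x) * (x t ^ (e - d) * f0 x))"
    have "g' \<in> polyfuns_below I t e" unfolding g'_def
      by (rule polyfuns_below_add[OF polyfuns_below_scale[OF gb(1) a]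
            polyfuns_below_scale[OF _ polyfuns_uminus[OF gb(2)]]])
         (use polyfuns_below_shift[OF f0, of "e - d"] de in auto)
    from Suc.IH[OF this] obtain k q r where
      qr: "q \<in> polyfuns_below I t (e - d)" "r \<in> polyfuns_below I t d"
         "\<forall>x. a x ^ k * g' x = q x * f x + r x" by (elim exE conjE) (rule that)
    define q' where "q' = (\<lambda>x. q x + (a x ^ k * b x) * x t ^ (e - d))"
    have "q' \<in> polyfuns_below I t (Suc e - d)"
      unfolding q'_def using polyfuns_below_Suc[OF qr(1)] a gb de
      by (simp add: Suc_diff_le polyfuns.mult polyfuns_power)
    moreover have "a x ^ Suc k * g x = q' x * f x + r x" for x
    proof -
      have e: "x t ^ e = x t ^ (e - d) * x t ^ d" using de by (simp flip: power_add)
      have ag: "a x * g x = g' x + b x * x t ^ (e - d) * f x"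
        by (simp add: gb g'_def f e algebra_simps)
      have "a x ^ Suc k * g x = a x ^ k * (a x * g x)" by simp
      also have "\<dots> = a x ^ k * g' x + a x ^ k * (b x * x t ^ (e - d) * f x)"
        unfolding ag by (rule distrib_left)
      also have "\<dots> = q' x * f x + r x" using qr(3)[rule_format, of x] by (simp add: q'_def
        algebra_simps)
      finally show ?thesis .
    qed
    ultimately show ?thesis using qr(2) by blast
  qed
qed

text \<open>Over the field of fractions of the functions without \<open>x t\<close>, such an
  \<open>f\<close> generates the ideal of \<open>W\<close>. Minimality is phrased so that a
  remainder vanishing on \<open>W\<close> is seen to be zero.\<close>

lemma minimal_annihilator:
  assumes "h \<in> polyfuns I" "h x0 \<noteq> 0" "\<forall>x\<in>W. h x = 0"
  shows "\<exists>d. \<exists>f\<in>polyfuns_below I t d. (\<exists>x. f x \<noteq> 0) \<and> (\<forall>x\<in>W. f x = 0) \<and>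
    (\<forall>e<d. \<forall>g\<in>polyfuns_below I t e. (\<forall>x\<in>W. g x = 0) \<longrightarrow> (\<forall>x. g x = 0))"
proof -
  define P where
    "P d \<longleftrightarrow> (\<exists>f\<in>polyfuns_below I t d. (\<exists>x. f x \<noteq> 0) \<and> (\<forall>x\<in>W. f x = 0))" for d
  have "\<exists>d. P d" unfolding P_def using polyfuns_imp_below[OF assms(1), of t] assms by blast
  then have "P (LEAST d. P d)" by (rule LeastI_ex)
  moreover have "\<not> P d'" if "d' < (LEAST d. P d)" for d' using not_less_Least that by blast
  ultimately show ?thesis unfolding P_def by blast
qed

text \<open>Let \<open>f\<close> be a nonzero function of least degree in \<open>x t\<close>
  vanishing on \<open>Z\<close>, with leading coefficient \<open>a\<close>. Pseudo-division makes
  some \<open>a^k u\<close> a multiple of \<open>f\<close> for every \<open>u\<close> vanishing on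
  \<open>Z\<close>, and by \<open>dom\<close> the function \<open>a\<close> does not vanish on all
  of \<open>Z\<close>. Primality of \<open>C\<close>, applied to an annihilator of \<open>C\<close>
  of least degree, shows that \<open>f\<close> vanishes on \<open>C\<close>; applied to
  \<open>a^k g = q f\<close>, it then shows the same for \<open>g\<close>.\<close>

lemma no_irreducible_between:
  assumes t: "t \<in> J" and ZC: "Z \<subseteq> C"
    and irr: "\<And>f g. f \<in> polyfuns J \<Longrightarrow> g \<in> polyfuns J \<Longrightarrow> (\<And>x. x \<in> C \<Longrightarrow> f x * g x = 0)
        \<Longrightarrow> (\<forall>x\<in>C. f x = 0) \<or> (\<forall>x\<in>C. g x = 0)"
    and dom: "\<And>f x. f \<in> polyfuns (J - {t}) \<Longrightarrow> (\<And>x. x \<in> Z \<Longrightarrow> f x = 0) \<Longrightarrow> f x = 0"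
    and h: "h \<in> polyfuns J" "h x0 \<noteq> 0" "\<And>x. x \<in> C \<Longrightarrow> h x = 0"
    and g: "g \<in> polyfuns J" "\<And>x. x \<in> Z \<Longrightarrow> g x = 0"
    and y: "y \<in> C"
  shows "g y = 0"
proof -
  obtain d f where f: "f \<in> polyfuns_below J t d" "\<exists>x. f x \<noteq> 0" "\<forall>x\<in>Z. f x = 0"
    and fmin: "\<forall>e<d. \<forall>g\<in>polyfuns_below J t e. (\<forall>x\<in>Z. g x = 0) \<longrightarrow> (\<forall>x. g x = 0)"
  proof -
    have "\<forall>x\<in>Z. h x = 0" using h(3) ZC by blast
    from minimal_annihilator[OF h(1,2) this, of t] show ?thesis by (auto intro: that)
  qed
  obtain d' where d': "d = Suc d'" using f(1,2) polyfuns_below_0[of f J t] by (cases d) auto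
  obtain f0 a where f0: "f0 \<in> polyfuns_below J t d'" and a: "a \<in> polyfuns (J - {t})"
    and feq: "f = (\<lambda>x. f0 x + a x * x t ^ d')"
    by (rule polyfuns_below_SucE[OF f(1)[unfolded d']])
  have aJ: "a \<in> polyfuns J" using a by (rule polyfuns_mono) auto
  have fJ: "f \<in> polyfuns J" using f(1) t by (rule polyfuns_below_imp)
  have "\<not> (\<forall>x. a x = 0)"
  proof
    assume "\<forall>x. a x = 0"
    then have "f = f0" by (auto simp: feq)
    then show False using fmin[rule_format, of d' f] f f0 d' by auto
  qed
  then obtain xa where xa: "a xa \<noteq> 0" by blast
  have aZ: "\<not> (\<forall>x\<in>Z. a x = 0)" using dom[OF a] xa by blast
  \<comment> \<open>In degree 0 the function \<open>f\<close> would equal \<open>a\<close>, which is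
    nonzero somewhere on \<open>Z\<close>.\<close>
  have d'pos: "d' > 0"
  proof (rule ccontr)
    assume "\<not> d' > 0"
    then have "f = a" using f0 polyfuns_below_0[of f0 J t] by (auto simp: feq fun_eq_iff)
    then show False using f aZ by blast
  qed
  have div: "\<exists>k q. q \<in> polyfuns_below J t (e - d') \<and> (\<forall>x. a x ^ k * u x = q x * f x)"
    if u: "u \<in> polyfuns_below J t e" "\<And>x. x \<in> Z \<Longrightarrow> u x = 0" for u e
  proof -
    obtain k q r where qr: "q \<in> polyfuns_below J t (e - d')" "r \<in> polyfuns_below J t d'"
      "\<forall>x. a x ^ k * u x = q x * f x + r x"
      using polyfuns_pseudo_division[OF f0 a feq u(1)] by (elim exE conjE) (rule that)
    have "r z = 0" if "z \<in> Z" for z using qr(3)[rule_format, of z] u(2) f(3) that by simp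
    then have "r x = 0" for x using fmin[rule_format, of d' r] qr(2) d' by blast
    then show ?thesis using qr by auto
  qed
  have fC: "\<forall>x\<in>C. f x = 0"
  proof -
    obtain e u where u: "u \<in> polyfuns_below J t e" "\<exists>x. u x \<noteq> 0" "\<forall>x\<in>C. u x = 0"
      and umin: "\<forall>e'<e. \<forall>g\<in>polyfuns_below J t e'. (\<forall>x\<in>C. g x = 0) \<longrightarrow> (\<forall>x. g x = 0)"
    proof -
      have "\<forall>x\<in>C. h x = 0" using h(3) by blast
      from minimal_annihilator[OF h(1,2) this, of t] show ?thesis by (auto intro: that)
    qed
    have e: "e > 0" using u(1,2) polyfuns_below_0[of u J t] by (cases e) auto
    obtain k q where q: "q \<in> polyfuns_below J t (e - d')" "\<And>x. a x ^ k * u x = q x * f x"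
      using div[OF u(1)] u(3) ZC by blast
    have "(\<forall>x\<in>C. q x = 0) \<or> (\<forall>x\<in>C. f x = 0)"
    proof (rule irr)
      show "q \<in> polyfuns J" using q(1) t by (rule polyfuns_below_imp)
      show "q x * f x = 0" if "x \<in> C" for x using u(3)[rule_format, OF that] by (simp flip: q(2))
    qed (rule fJ)
    \<comment> \<open>If \<open>q\<close> vanished on \<open>C\<close>, its smaller degree would
      make it zero everywhere, although \<open>a^k u\<close> is not.\<close>
    moreover have "\<not> (\<forall>x\<in>C. q x = 0)"
    proof
      assume "\<forall>x\<in>C. q x = 0"
      then have q0: "q x = 0" for x using umin[rule_format, of "e - d'" q] q(1) e d'pos by auto
      obtain xu where "u xu \<noteq> 0" using u(2) by blast
      then obtain x where "a x \<noteq> 0" "u x \<noteq> 0"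
        using polyfuns_mult_nonzero[OF aJ polyfuns_below_imp[OF u(1) t] xa] by blast
      then show False using q(2)[of x] q0 by simp
    qed
    ultimately show ?thesis by blast
  qed
  obtain e where "g \<in> polyfuns_below J t e" using polyfuns_imp_below[OF g(1)] by blast
  then obtain k q where q: "\<And>x. a x ^ k * g x = q x * f x" using div g(2) by blast
  have "(\<forall>x\<in>C. a x ^ k = 0) \<or> (\<forall>x\<in>C. g x = 0)"
    by (rule irr) (use q fC aJ g(1) polyfuns_power in auto)
  moreover have "\<not> (\<forall>x\<in>C. a x ^ k = 0)" using aZ ZC by auto
  ultimately show ?thesis using y by blast
qed

section \<open>Evaluation of polynomials\<close>

definition eval_monom :: "'v monom \<Rightarrow> ('v \<Rightarrow> complex) \<Rightarrow> complex" where
  "eval_monom m x = (\<Prod>i\<in>Poly_Mapping.keys m. x i ^ Poly_Mapping.lookup m i)"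

lemma eval_monom_superset:
  assumes "finite A" "Poly_Mapping.keys m \<subseteq> A"
  shows "eval_monom m x = (\<Prod>i\<in>A. x i ^ Poly_Mapping.lookup m i)"
  unfolding eval_monom_def using assms
  by (intro prod.mono_neutral_left) (auto simp: in_keys_iff)

lemma eval_monom_add: "eval_monom (m + m') x = eval_monom m x * eval_monom m' x"
proof -
  let ?A = "Poly_Mapping.keys m \<union> Poly_Mapping.keys m'"
  have "eval_monom (m + m') x = (\<Prod>i\<in>?A. x i ^ Poly_Mapping.lookup (m + m') i)"
    by (rule eval_monom_superset) (auto simp: Poly_Mapping.keys_add)
  also have "\<dots> = eval_monom m x * eval_monom m' x"
    by (simp add: eval_monom_superset[of ?A] lookup_add power_add prod.distrib)
  finally show ?thesis .
qed

lemma eval_poly_superset: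
  assumes "finite A" "Poly_Mapping.keys p \<subseteq> A"
  shows "eval_poly p x = (\<Sum>m\<in>A. Poly_Mapping.lookup p m * eval_monom m x)"
  unfolding eval_poly_def eval_monom_def[symmetric] using assms
  by (intro sum.mono_neutral_left) (auto simp: in_keys_iff)

lemma eval_poly_eq:
  "eval_poly p x = (\<Sum>m\<in>Poly_Mapping.keys p. Poly_Mapping.lookup p m * eval_monom m x)"
  unfolding eval_poly_def eval_monom_def ..

lemma eval_poly_add: "eval_poly (p + q) x = eval_poly p x + eval_poly q x"
proof -
  let ?A = "Poly_Mapping.keys p \<union> Poly_Mapping.keys q"
  have "eval_poly (p + q) x = (\<Sum>m\<in>?A. Poly_Mapping.lookup (p + q) m * eval_monom m x)"
    by (rule eval_poly_superset) (auto simp: Poly_Mapping.keys_add)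
  also have "\<dots> = eval_poly p x + eval_poly q x"
    by (simp add: eval_poly_superset[of ?A] lookup_add distrib_right sum.distrib)
  finally show ?thesis .
qed

lemma eval_poly_zero [simp]: "eval_poly 0 x = 0"
  by (simp add: eval_poly_eq)

lemma eval_poly_single: "eval_poly (Poly_Mapping.single m c) x = c * eval_monom m x"
  by (subst eval_poly_superset[of "{m}"]) auto

lemma eval_poly_sum: "eval_poly (\<Sum>a\<in>A. p a) x = (\<Sum>a\<in>A. eval_poly (p a) x)"
  by (induction A rule: infinite_finite_induct) (auto simp: eval_poly_add)

lemma sum_singles:
  "finite A \<Longrightarrow> Poly_Mapping.keys p \<subseteq> A \<Longrightarrow>
     (\<Sum>m\<in>A. Poly_Mapping.single m (Poly_Mapping.lookup p m)) = p"
  by (rule poly_mapping_eqI) (auto simp: lookup_sum lookup_single when_def in_keys_iff)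

lemma eval_poly_mult: "eval_poly (p * q) x = eval_poly p x * eval_poly q x"
proof -
  let ?s = "\<lambda>p m. Poly_Mapping.single m (Poly_Mapping.lookup p m)"
  let ?P = "Poly_Mapping.keys p" and ?Q = "Poly_Mapping.keys q"
  have "p * q = (\<Sum>m\<in>?P. ?s p m) * (\<Sum>m\<in>?Q. ?s q m)"
    by (simp add: sum_singles)
  also have "\<dots> = (\<Sum>m\<in>?P. \<Sum>m'\<in>?Q. Poly_Mapping.single (m + m')
      (Poly_Mapping.lookup p m * Poly_Mapping.lookup q m'))"
    by (simp add: sum_product mult_single)
  finally have "eval_poly (p * q) x = (\<Sum>m\<in>?P. \<Sum>m'\<in>?Q.
      Poly_Mapping.lookup p m * Poly_Mapping.lookup q m' * (eval_monom m x * eval_monom m' x))"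
    by (simp add: eval_poly_sum eval_poly_single eval_monom_add)
  also have "\<dots> = eval_poly p x * eval_poly q x"
    by (simp add: eval_poly_eq sum_product mult_ac)
  finally show ?thesis .
qed

lemma mdegree_superset:
  assumes "finite A" "Poly_Mapping.keys m \<subseteq> A"
  shows "mdegree m = (\<Sum>i\<in>A. Poly_Mapping.lookup m i)"
  unfolding mdegree_def using assms
  by (intro sum.mono_neutral_left) (auto simp: in_keys_iff)

lemma mdegree_add: "mdegree (m + m') = mdegree m + mdegree m'"
proof -
  let ?A = "Poly_Mapping.keys m \<union> Poly_Mapping.keys m'"
  have "mdegree (m + m') = (\<Sum>i\<in>?A. Poly_Mapping.lookup (m + m') i)"
    by (rule mdegree_superset) (auto simp: Poly_Mapping.keys_add)
  also have "\<dots> = mdegree m + mdegree m'"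
    by (simp add: mdegree_superset[of ?A] lookup_add sum.distrib)
  finally show ?thesis .
qed

lemma mdegree_single: "mdegree (Poly_Mapping.single i k) = k"
  by (simp add: mdegree_def)

lemma monoms_add: "m \<in> monoms I d \<Longrightarrow> m' \<in> monoms I e \<Longrightarrow> m + m' \<in> monoms I (d + e)"
  using Poly_Mapping.keys_add[of m m'] by (auto simp: monoms_def mdegree_add)

lemma monoms_0: "0 \<in> monoms I 0"
  by (simp add: monoms_def mdegree_def)

lemma monoms_single: "i \<in> I \<Longrightarrow> Poly_Mapping.single i k \<in> monoms I k"
  by (simp add: monoms_def mdegree_single)

lemma finite_monoms:
  assumes "finite I"
  shows "finite (monoms I d)"
proof (rule finite_imageD)
  show "inj_on Poly_Mapping.lookup (monoms I d)"
    by (auto simp: inj_on_def poly_mapping_eqI)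
  have "Poly_Mapping.lookup m i \<le> d" if "m \<in> monoms I d" for m i
    using that member_le_sum[of i "Poly_Mapping.keys m" "Poly_Mapping.lookup m"]
    by (cases "i \<in> Poly_Mapping.keys m") (auto simp: monoms_def mdegree_def in_keys_iff)
  moreover have "Poly_Mapping.lookup m i = 0" if "m \<in> monoms I d" "i \<notin> I" for m i
    using that by (auto simp: monoms_def in_keys_iff)
  ultimately have "Poly_Mapping.lookup ` monoms I d
      \<subseteq> {f. \<forall>i. (i \<in> I \<longrightarrow> f i \<in> {..d}) \<and> (i \<notin> I \<longrightarrow> f i = 0)}"
    by auto
  then show "finite (Poly_Mapping.lookup ` monoms I d)"
    by (rule finite_subset) (use finite_set_of_finite_funs[OF assms, of "{..d}" 0] in auto)
qed

lemma forms_single: "m \<in> monoms I d \<Longrightarrow> Poly_Mapping.single m c \<in> forms I d"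
  by (simp add: forms_def)

lemma forms_add: "p \<in> forms I d \<Longrightarrow> q \<in> forms I d \<Longrightarrow> p + q \<in> forms I d"
  using Poly_Mapping.keys_add[of p q] by (auto simp: forms_def)

lemma forms_zero: "0 \<in> forms I d"
  by (simp add: forms_def)

lemma forms_sum: "(\<And>a. a \<in> A \<Longrightarrow> p a \<in> forms I d) \<Longrightarrow> (\<Sum>a\<in>A. p a) \<in> forms I d"
  by (induction A rule: infinite_finite_induct) (auto simp: forms_add forms_zero)

lemma forms_mult:
  assumes "p \<in> forms I d" "q \<in> forms I e"
  shows "p * q \<in> forms I (d + e)"
  using keys_mult[of p q] assms monoms_add by (fastforce simp: forms_def)

lemma forms_power: "p \<in> forms I d \<Longrightarrow> p ^ k \<in> forms I (k * d)"
proof (induction k)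
  case 0
  then show ?case
    using forms_single[OF monoms_0, of 1 I] by simp
next
  case (Suc k)
  then show ?case using forms_mult[OF Suc.prems Suc.IH] by (simp add: add.commute)
qed

lemma eval_poly_one [simp]: "eval_poly 1 x = 1"
  using eval_poly_single[of 0 1 x] by (simp add: eval_monom_def)

lemma eval_poly_power: "eval_poly (p ^ k) x = eval_poly p x ^ k"
  by (induction k) (auto simp: eval_poly_mult)

lemma polyfuns_eval_poly:
  assumes "p \<in> forms I k"
  shows "eval_poly p \<in> polyfuns I"
proof -
  have "(\<lambda>x. eval_poly p x) \<in> polyfuns I"
    unfolding eval_poly_def
    using assms by (intro polyfuns_sum polyfuns.mult polyfuns.const polyfuns_prod polyfuns_power
      polyfuns.var)
      (auto simp: forms_def monoms_def)
  then show ?thesis by simp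
qed

lemma eval_poly_homogeneous:
  assumes p: "p \<in> forms I k" and y: "\<And>i. i \<in> I \<Longrightarrow> y i = c * x i"
  shows "eval_poly p y = c ^ k * eval_poly p x"
proof -
  have "eval_monom m y = c ^ k * eval_monom m x" if m: "m \<in> Poly_Mapping.keys p" for m
  proof -
    have "Poly_Mapping.keys m \<subseteq> I" "mdegree m = k" using m p by (auto simp: forms_def monoms_def)
    then have "eval_monom m y = (\<Prod>i\<in>Poly_Mapping.keys m. c ^ Poly_Mapping.lookup m i * x i ^
      Poly_Mapping.lookup m i)"
      unfolding eval_monom_def using y by (intro prod.cong) (auto simp: power_mult_distrib)
    also have "\<dots> = c ^ k * eval_monom m x"
      using \<open>mdegree m = k\<close> by (simp add: prod.distrib eval_monom_def mdegree_def flip: power_sum)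
    finally show ?thesis .
  qed
  then show ?thesis by (simp add: eval_poly_eq sum_distrib_left mult_ac)
qed

lemma lookup_scale_poly: "Poly_Mapping.lookup (scale_poly c p) m = c * Poly_Mapping.lookup p m"
proof -
  have "scale_poly c p = Poly_Mapping.map ((*) c) p"
    by (simp add: scale_poly_def mult_map_scale_conv_mult)
  then show ?thesis by (simp add: Poly_Mapping.map.rep_eq when_def)
qed

lemma subspace_forms: "cpoly.subspace (forms I d)"
  by (auto simp: cpoly.subspace_def forms_zero forms_add)
    (auto simp: forms_def in_keys_iff lookup_scale_poly subset_iff)

section \<open>Lists of polynomials and their minors\<close>

lemma span_list:
  assumes "x \<in> cpoly.span (set bs)"
  shows "\<exists>c. x = (\<Sum>j<length bs. scale_poly (c j) (bs ! j))"
proof -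
  let ?S = "{x. \<exists>c. x = (\<Sum>j<length bs. scale_poly (c j) (bs ! j))}"
  have "cpoly.subspace ?S"
    unfolding cpoly.subspace_def
  proof safe
    show "\<exists>c. 0 = (\<Sum>j<length bs. scale_poly (c j) (bs ! j))"
      by (rule exI[of _ "\<lambda>_. 0"]) simp
    show "\<exists>c'. (\<Sum>j<length bs. scale_poly (c j) (bs ! j)) + (\<Sum>j<length bs. scale_poly (d j) (bs ! j))
        = (\<Sum>j<length bs. scale_poly (c' j) (bs ! j))" for c d
      by (rule exI[of _ "\<lambda>j. c j + d j"]) (simp add: cpoly.scale_left_distrib sum.distrib)
    show "\<exists>c'. scale_poly a (\<Sum>j<length bs. scale_poly (c j) (bs ! j))
        = (\<Sum>j<length bs. scale_poly (c' j) (bs ! j))" for a c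
      by (rule exI[of _ "\<lambda>j. a * c j"]) (simp add: cpoly.scale_sum_right)
  qed
  moreover have "set bs \<subseteq> ?S"
  proof
    fix b assume "b \<in> set bs"
    then obtain i where i: "i < length bs" "b = bs ! i" by (auto simp: in_set_conv_nth)
    have "b = (\<Sum>j<length bs. scale_poly (if j = i then 1 else 0) (bs ! j))"
      using i by (simp add: if_distrib[of "\<lambda>c. scale_poly c _"] sum.delta cong: if_cong)
    then show "b \<in> ?S" by auto
  qed
  ultimately have "cpoly.span (set bs) \<subseteq> ?S" by (intro cpoly.span_minimal)
  then show ?thesis using assms by blast
qed

text \<open>Relations are indexed by positions, so a repeated entry already violates the hypothesis,
  with coefficients 1 and -1.\<close>

lemma independent_listI:
  assumes "\<And>c j. (\<Sum>j<length bs. scale_poly (c j) (bs ! j)) = 0 \<Longrightarrow> j < length bs \<Longrightarrow> c j = 0"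
  shows "distinct bs \<and> cpoly.independent (set bs)"
proof
  show d: "distinct bs"
  proof (rule ccontr)
    assume "\<not> distinct bs"
    then obtain i j where ij: "i < length bs" "j < length bs" "i \<noteq> j" "bs ! i = bs ! j"
      by (auto simp: distinct_conv_nth)
    define c where "c k = (if k = i then 1 else if k = j then -1 else 0 :: complex)" for k
    have "(\<Sum>k<length bs. scale_poly (c k) (bs ! k)) = (\<Sum>k\<in>{i, j}. scale_poly (c k) (bs ! k))"
      using ij by (intro sum.mono_neutral_right) (auto simp: c_def)
    also have "\<dots> = 0" using ij by (simp add: c_def)
    finally show False using assms[of c i] ij by (simp add: c_def)
  qed
  show "cpoly.independent (set bs)"
  proof (rule cpoly.independent_if_scalars_zero)
    fix f x assume s: "(\<Sum>x\<in>set bs. scale_poly (f x) x) = 0" and x: "x \<in> set bs"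
    have "(\<Sum>x\<in>set bs. scale_poly (f x) x) = (\<Sum>j<length bs. scale_poly (f (bs ! j)) (bs ! j))"
      by (rule sum.reindex_bij_betw[symmetric]) (rule bij_betw_nth[OF d refl refl])
    then show "f x = 0" using s x assms[of "\<lambda>j. f (bs ! j)"] by (auto simp: in_set_conv_nth)
  qed simp
qed

text \<open>A relation between the rows is a kernel vector of the transposed minor.\<close>

lemma pluecker_nonzero_imp_independent:
  assumes "pluecker bs ms \<noteq> 0"
  shows "distinct bs \<and> cpoly.independent (set bs)"
proof (rule independent_listI, rule ccontr)
  fix c j assume s: "(\<Sum>j<length bs. scale_poly (c j) (bs ! j)) = 0" and j: "j < length bs" "c j \<noteq> 0"
  let ?r = "length bs"
  let ?A = "mat ?r ?r (\<lambda>(i, j). Poly_Mapping.lookup (bs ! i) (ms ! j))"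
  have "transpose_mat ?A *\<^sub>v vec ?r c = 0\<^sub>v ?r"
  proof (rule eq_vecI)
    fix k assume k: "k < dim_vec (0\<^sub>v ?r)"
    have "(transpose_mat ?A *\<^sub>v vec ?r c) $ k = (\<Sum>j<?r. Poly_Mapping.lookup (bs ! j) (ms ! k) * c
      j)"
      using k by (simp add: scalar_prod_def lessThan_atLeast0)
    also have "\<dots> = Poly_Mapping.lookup (\<Sum>j<?r. scale_poly (c j) (bs ! j)) (ms ! k)"
      by (simp add: lookup_sum lookup_scale_poly mult.commute)
    finally show "(transpose_mat ?A *\<^sub>v vec ?r c) $ k = 0\<^sub>v ?r $ k" using k s by simp
  qed simp
  moreover have "vec ?r c \<noteq> 0\<^sub>v ?r"
  proof
    assume "vec ?r c = 0\<^sub>v ?r"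
    then have "vec ?r c $ j = 0" using j by simp
    then show False using j by simp
  qed
  moreover have "vec ?r c \<in> carrier_vec ?r" by simp
  ultimately have "\<exists>v. v \<in> carrier_vec ?r \<and> v \<noteq> 0\<^sub>v ?r \<and> transpose_mat ?A *\<^sub>v v = 0\<^sub>v ?r"
    by blast
  then have "det (transpose_mat ?A) = 0"
    by (subst det_0_iff_vec_prod_zero_field[of _ ?r]) simp_all
  then have "det ?A = 0" by (simp add: det_transpose[of _ ?r])
  then show False using assms by (simp add: pluecker_def)
qed

text \<open>The factor is the determinant of the matrix that expresses \<open>cs\<close> through
  \<open>bs\<close>, the same for all \<open>ms\<close>.\<close>

lemma pluecker_span:
  assumes "set cs \<subseteq> cpoly.span (set bs)" "length cs = length bs"
  shows "\<exists>c. \<forall>ms. pluecker cs ms = c * pluecker bs ms"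
proof -
  let ?r = "length bs"
  have "\<forall>i. \<exists>c. i < ?r \<longrightarrow> cs ! i = (\<Sum>j<?r. scale_poly (c j) (bs ! j))"
    using assms span_list[of _ bs] by (metis nth_mem subsetD)
  then obtain P where P: "\<And>i. i < ?r \<Longrightarrow> cs ! i = (\<Sum>j<?r. scale_poly (P i j) (bs ! j))"
    by metis
  have "pluecker cs ms = det (mat ?r ?r (\<lambda>(i, j). P i j)) * pluecker bs ms" for ms
  proof -
    have "mat ?r ?r (\<lambda>(i, j). Poly_Mapping.lookup (cs ! i) (ms ! j))
      = mat ?r ?r (\<lambda>(i, j). P i j) * mat ?r ?r (\<lambda>(i, j). Poly_Mapping.lookup (bs ! i) (ms ! j))"
      by (rule eq_matI)
         (auto simp: P scalar_prod_def lookup_sum lookup_scale_poly lessThan_atLeast0)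
    then show ?thesis unfolding pluecker_def assms(2)
      by (simp add: det_mult[of _ ?r])
  qed
  then show ?thesis by blast
qed

lemma span_eq_if_length_le:
  assumes sub: "set cs \<subseteq> cpoly.span (set bs)" and l: "length bs \<le> length cs"
    and ind: "distinct cs" "cpoly.independent (set cs)"
  shows "cpoly.span (set cs) = cpoly.span (set bs)"
proof
  show "cpoly.span (set cs) \<subseteq> cpoly.span (set bs)"
    using sub cpoly.span_minimal cpoly.subspace_span by blast
  have "set bs \<subseteq> cpoly.span (set cs)"
  proof (rule ccontr)
    assume "\<not> set bs \<subseteq> cpoly.span (set cs)"
    then obtain b where b: "b \<in> set bs" "b \<notin> cpoly.span (set cs)" by blast
    then have "b \<notin> set cs" using cpoly.span_base by blast
    have "card (insert b (set cs)) \<le> card (set bs)"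
      using cpoly.independent_span_bound[of "set bs" "insert b (set cs)"]
        cpoly.independent_insertI[OF b(2) ind(2)] sub b(1) cpoly.span_base by auto
    also have "\<dots> \<le> length bs" by (rule card_length)
    finally show False using \<open>b \<notin> set cs\<close> l distinct_card[OF ind(1)] by simp
  qed
  then show "cpoly.span (set bs) \<subseteq> cpoly.span (set cs)"
    using cpoly.span_minimal cpoly.subspace_span by blast
qed

section \<open>Irreducible closed sets\<close>

lemma irreducible_closed_Int:
  assumes Z: "irreducible_closed X Z" and U: "openin X U" "U \<inter> Z \<noteq> {}" and V: "openin X V" "V \<inter> Z
    \<noteq> {}"
  shows "U \<inter> V \<inter> Z \<noteq> {}"
proof
  assume e: "U \<inter> V \<inter> Z = {}"
  have "closedin X (Z - U)" "closedin X (Z - V)"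
    using Z U V by (auto simp: irreducible_closed_def intro: closedin_diff)
  moreover have "Z = (Z - U) \<union> (Z - V)" using e by blast
  ultimately have "Z = Z - U \<or> Z = Z - V" using Z unfolding irreducible_closed_def by blast
  then show False using U V by blast
qed

lemma irreducible_closed_closure_of:
  assumes S: "S \<subseteq> topspace X" "S \<noteq> {}"
    and int: "\<And>U V. openin X U \<Longrightarrow> openin X V \<Longrightarrow> U \<inter> S \<noteq> {} \<Longrightarrow> V \<inter> S \<noteq> {} \<Longrightarrow> U \<inter> V \<inter> S \<noteq> {}"
  shows "irreducible_closed X (X closure_of S)"
  unfolding irreducible_closed_def
proof (intro conjI allI impI)
  show "X closure_of S \<noteq> {}" using closure_of_subset[OF S(1)] S(2) by blast
  fix A B assume AB: "closedin X A \<and> closedin X B \<and> X closure_of S = A \<union> B"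
  have "S \<subseteq> A \<or> S \<subseteq> B"
  proof (rule ccontr)
    assume c: "\<not> ?thesis"
    have "(topspace X - A) \<inter> (topspace X - B) \<inter> S \<noteq> {}"
      by (rule int) (use AB S c in auto)
    then show False using AB closure_of_subset[OF S(1)] by blast
  qed
  then show "X closure_of S = A \<or> X closure_of S = B"
    using AB closure_of_minimal[of S _ X] by (metis Un_upper1 Un_upper2 subset_antisym)
qed simp

section \<open>Charts of the Grassmannian\<close>

text \<open>\<open>pv\<close> lists the pivot columns. The chart consists of the subspaces whose
  Pluecker coordinate at \<open>pv\<close> is nonzero; each has a unique basis with the identity
  matrix in these columns.\<close>

locale grass_chart =
  fixes n d r :: nat and pv :: "nat monom list"
  assumes r_pos: "0 < r" and length_pv: "length pv = r" and distinct_pv: "distinct pv"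
    and pv_monoms: "set pv \<subseteq> monoms {..n} d"
begin

abbreviation "X \<equiv> zariski_Grass n d r"

definition entries :: "(nat \<times> nat monom) set" where
  "entries = {..<r} \<times> monoms {..n} d"

text \<open>For \<open>n = 3\<close>, \<open>d = 2\<close>, \<open>r = 3\<close> these are 3 * (10 -
  3) = 21 coordinates, the dimension of the Grassmannian.\<close>

definition free_entries :: "(nat \<times> nat monom) set" where
  "free_entries = {..<r} \<times> (monoms {..n} d - set pv)"

definition row_forms :: "(nat \<times> nat monom \<Rightarrow> complex) \<Rightarrow> nat cpoly list" where
  "row_forms N = map (\<lambda>i. \<Sum>m\<in>monoms {..n} d. Poly_Mapping.single m (N (i, m))) [0..<r]"

abbreviation rowspan :: "(nat \<times> nat monom \<Rightarrow> complex) \<Rightarrow> nat cpoly set" where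
  "rowspan N \<equiv> cpoly.span (set (row_forms N))"

definition full_rank :: "(nat \<times> nat monom \<Rightarrow> complex) \<Rightarrow> bool" where
  "full_rank N \<longleftrightarrow> distinct (row_forms N) \<and> cpoly.independent (set (row_forms N))"

lemma length_row_forms [simp]: "length (row_forms N) = r"
  by (simp add: row_forms_def)

lemma lookup_row_forms:
  "i < r \<Longrightarrow> Poly_Mapping.lookup (row_forms N ! i) m = (if m \<in> monoms {..n} d then N (i, m) else 0)"
  using finite_monoms[of "{..n}" d]
  by (auto simp: row_forms_def lookup_sum lookup_single when_def sum.delta)

lemma row_forms_cong: "(\<And>k. k \<in> entries \<Longrightarrow> N k = N' k) \<Longrightarrow> row_forms N = row_forms N'"
  by (auto simp: row_forms_def entries_def intro!: sum.cong)

lemma row_forms_lookup: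
  assumes "length bs = r" "set bs \<subseteq> Sd n d"
  shows "row_forms (\<lambda>(i, m). Poly_Mapping.lookup (bs ! i) m) = bs"
proof (rule nth_equalityI)
  fix i assume "i < length (row_forms (\<lambda>(i, m). Poly_Mapping.lookup (bs ! i) m))"
  then have i: "i < r" by simp
  then have "bs ! i \<in> Sd n d" using assms by auto
  then show "row_forms (\<lambda>(i, m). Poly_Mapping.lookup (bs ! i) m) ! i = bs ! i"
    by (intro poly_mapping_eqI) (auto simp: lookup_row_forms i Sd_def forms_def in_keys_iff)
qed (use assms in simp)

lemma row_forms_in_Sd: "set (row_forms N) \<subseteq> Sd n d"
  by (auto simp: row_forms_def Sd_def intro!: forms_sum forms_single)

lemma pluecker_row_forms:
  assumes "length ms = r" "set ms \<subseteq> monoms {..n} d"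
  shows "pluecker (row_forms N) ms = det (mat r r (\<lambda>(i, j). N (i, ms ! j)))"
proof -
  have "mat r r (\<lambda>(i, j). Poly_Mapping.lookup (row_forms N ! i) (ms ! j)) = mat r r (\<lambda>(i, j). N
    (i, ms ! j))"
    using assms by (intro eq_matI) (auto simp: lookup_row_forms subset_iff)
  then show ?thesis by (simp add: pluecker_def)
qed

lemma polyfuns_pluecker_row_forms:
  assumes "ms \<in> pluecker_index n d r"
  shows "(\<lambda>N. pluecker (row_forms N) ms) \<in> polyfuns entries"
proof -
  have ms: "length ms = r" "set ms \<subseteq> monoms {..n} d" using assms by (auto simp: pluecker_index_def)
  have "(\<lambda>N. det (mat r r (\<lambda>(i, j). N (i, ms ! j)))) \<in> polyfuns entries"
    by (rule polyfuns_det) (use ms in \<open>auto simp: entries_def intro!: polyfuns.var\<close>)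
  then show ?thesis by (simp add: pluecker_row_forms[OF ms])
qed

lemma pv_in_index: "pv \<in> pluecker_index n d r"
  using length_pv pv_monoms by (simp add: pluecker_index_def)

lemma rowspan_in_Grass: "full_rank N \<Longrightarrow> rowspan N \<in> Grass n d r"
proof -
  assume f: "full_rank N"
  have "cpoly.span (set (row_forms N)) \<subseteq> Sd n d"
    by (rule cpoly.span_minimal[OF row_forms_in_Sd]) (simp add: Sd_def subspace_forms)
  moreover have "cpoly.dim (rowspan N) = r"
    using f distinct_card[of "row_forms N"] by (simp add: full_rank_def
      cpoly.dim_eq_card_independent)
  ultimately show ?thesis by (simp add: Grass_def cpoly.subspace_span)
qed

lemma ordered_basis_rows: "full_rank N \<Longrightarrow> ordered_basis (row_forms N) (rowspan N)"
  by (simp add: full_rank_def ordered_basis_def)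

lemma Grass_ordered_basis:
  assumes "L \<in> Grass n d r" "ordered_basis bs L"
  shows "length bs = r" "set bs \<subseteq> Sd n d"
proof -
  have L: "cpoly.dim L = r" "L \<subseteq> Sd n d" using assms by (auto simp: Grass_def)
  have bs: "distinct bs" "cpoly.independent (set bs)" "cpoly.span (set bs) = L"
    using assms by (auto simp: ordered_basis_def)
  show "length bs = r"
    using bs L distinct_card[of bs] cpoly.dim_span_eq_card_independent[OF bs(2)] by simp
  show "set bs \<subseteq> Sd n d" using bs(3) L(2) cpoly.span_superset[of "set bs"] by blast
qed

lemma Grass_obtain_basis:
  assumes "L \<in> Grass n d r"
  obtains bs where "ordered_basis bs L"
proof -
  have L: "cpoly.dim L = r" "cpoly.subspace L" using assms by (auto simp: Grass_def)
  obtain B where B: "B \<subseteq> L" "cpoly.independent B" "L \<subseteq> cpoly.span B" "card B = cpoly.dim L"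
    by (rule cpoly.basis_exists)
  have "finite B" using B(4) L r_pos by (simp add: card_ge_0_finite)
  then obtain bs where bs: "set bs = B" "distinct bs" using finite_distinct_list by blast
  have "cpoly.span B = L" using B L(2) cpoly.span_minimal by blast
  then show ?thesis using that[of bs] bs B by (simp add: ordered_basis_def)
qed

lemma Grass_obtain_rows:
  assumes "L \<in> Grass n d r"
  obtains N where "full_rank N" "rowspan N = L"
proof -
  obtain bs where bs: "ordered_basis bs L" using Grass_obtain_basis[OF assms] .
  have "row_forms (\<lambda>(i, m). Poly_Mapping.lookup (bs ! i) m) = bs"
    by (rule row_forms_lookup) (use Grass_ordered_basis[OF assms bs] in auto)
  then show ?thesis using bs
    by (intro that[of "\<lambda>(i, m). Poly_Mapping.lookup (bs ! i) m"]) (auto simp: full_rank_def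
      ordered_basis_def)
qed

lemma topspace_Grass: "topspace X = Grass n d r"
proof -
  have "nonvanishing n d r 1 = Grass n d r"
    using Grass_obtain_basis by (auto simp: nonvanishing_def)
  moreover have "1 \<in> forms (pluecker_index n d r) 0"
    using forms_single[OF monoms_0, of 1] by simp
  ultimately have "Grass n d r \<subseteq> topspace X"
    unfolding zariski_Grass_def topology_generated_by_topspace by blast
  moreover have "topspace X \<subseteq> Grass n d r"
    unfolding zariski_Grass_def topology_generated_by_topspace by (auto simp: nonvanishing_def)
  ultimately show ?thesis by blast
qed

lemma openin_nonvanishing:
  "F \<in> forms (pluecker_index n d r) k \<Longrightarrow> openin X (nonvanishing n d r F)"
  unfolding zariski_Grass_def by (rule topology_generated_by_Basis) blast

lemma eval_pluecker_basis:
  assumes F: "F \<in> forms (pluecker_index n d r) k"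
    and bs: "set bs \<subseteq> cpoly.span (set cs)" "length bs = length cs"
    and nz: "eval_poly F (pluecker bs) \<noteq> 0"
  shows "eval_poly F (pluecker cs) \<noteq> 0"
proof -
  obtain c where "\<And>ms. pluecker bs ms = c * pluecker cs ms" using pluecker_span[OF bs] by blast
  then have "eval_poly F (pluecker bs) = c ^ k * eval_poly F (pluecker cs)"
    using eval_poly_homogeneous[OF F] by blast
  then show ?thesis using nz by auto
qed

text \<open>The translation from the generated topology to polynomials in the matrix entries.
  Intersections multiply the functions, a union keeps that of one member, and for a generator
  \<open>F\<close> is composed with the minors.\<close>

lemma openin_rowspan:
  assumes "openin X U" "full_rank N" "rowspan N \<in> U"
  shows "\<exists>f\<in>polyfuns entries. f N \<noteq> 0 \<and> (\<forall>N'. full_rank N' \<longrightarrow> f N' \<noteq> 0 \<longrightarrow> rowspan N' \<in> U)"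
proof -
  have "generate_topology_on {nonvanishing n d r F | F k. F \<in> forms (pluecker_index n d r) k} U"
    using assms(1) unfolding zariski_Grass_def by (rule openin_topology_generated_by)
  then show ?thesis using assms(3)
  proof (induction rule: generate_topology_on.induct)
    case Empty
    then show ?case by simp
  next
    case (Int a b)
    then obtain f g where "f \<in> polyfuns entries" "f N \<noteq> 0" "g \<in> polyfuns entries" "g N \<noteq> 0"
      "\<forall>N'. full_rank N' \<longrightarrow> f N' \<noteq> 0 \<longrightarrow> rowspan N' \<in> a"
      "\<forall>N'. full_rank N' \<longrightarrow> g N' \<noteq> 0 \<longrightarrow> rowspan N' \<in> b" by blast
    then show ?case by (intro bexI[of _ "\<lambda>N. f N * g N"]) (auto intro: polyfuns.mult)
  next
    case (UN K)
    then obtain k where k: "k \<in> K" "rowspan N \<in> k" by blast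
    from UN.IH[OF this] show ?case using k(1) by blast
  next
    case (Basis s)
    then obtain F k where F: "F \<in> forms (pluecker_index n d r) k" "s = nonvanishing n d r F" by
      blast
    obtain bs where bs: "ordered_basis bs (rowspan N)" "eval_poly F (pluecker bs) \<noteq> 0"
      using Basis F by (auto simp: nonvanishing_def)
    have "(\<lambda>N. eval_poly F (pluecker (row_forms N))) \<in> polyfuns entries"
      using polyfuns_pluecker_row_forms by (rule polyfuns_comp[OF polyfuns_eval_poly[OF F(1)]])
    moreover have "eval_poly F (pluecker (row_forms N)) \<noteq> 0"
    proof (rule eval_pluecker_basis[OF F(1) _ _ bs(2)])
      show "set bs \<subseteq> rowspan N"
        using bs(1) cpoly.span_superset unfolding ordered_basis_def by blast
      show "length bs = length (row_forms N)"
        using Grass_ordered_basis(1)[OF rowspan_in_Grass[OF assms(2)] bs(1)] by simp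
    qed
    moreover have "rowspan N' \<in> s" if "full_rank N'" "eval_poly F (pluecker (row_forms N')) \<noteq> 0"
      for N'
      using that rowspan_in_Grass ordered_basis_rows F(2) by (auto simp: nonvanishing_def)
    ultimately show ?case by (intro bexI[of _ "\<lambda>N. eval_poly F (pluecker (row_forms N))"]) auto
  qed
qed

section \<open>The affine cell of reduced matrices\<close>

definition chart :: "(nat \<times> nat monom \<Rightarrow> complex) \<Rightarrow> nat \<times> nat monom \<Rightarrow> complex" where
  "chart x = (\<lambda>(i, m). if m \<in> set pv then (if pv ! i = m then 1 else 0) else x (i, m))"

lemma polyfuns_chart: "k \<in> entries \<Longrightarrow> (\<lambda>x. chart x k) \<in> polyfuns free_entries"
  by (cases k, cases "snd k \<in> set pv")
    (auto simp: chart_def entries_def free_entries_def intro: polyfuns.intros)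

lemma pluecker_chart_pv: "pluecker (row_forms (chart x)) pv = 1"
proof -
  have "mat r r (\<lambda>(i, j). chart x (i, pv ! j)) = 1\<^sub>m r"
    using length_pv distinct_pv by (intro eq_matI) (auto simp: chart_def nth_eq_iff_index_eq)
  then show ?thesis by (simp add: pluecker_row_forms[OF length_pv pv_monoms])
qed

text \<open>Exchanging pivot \<open>i\<close> for \<open>m\<close> puts column \<open>m\<close> in
  place of column \<open>i\<close> of the identity, and Cramer's rule reads off one entry.\<close>

lemma pluecker_chart_update:
  assumes "(i, m) \<in> free_entries"
  shows "pluecker (row_forms (chart x)) (pv[i := m]) = x (i, m)"
proof -
  have i: "i < r" "m \<in> monoms {..n} d" "m \<notin> set pv" using assms by (auto simp: free_entries_def)
  let ?v = "vec r (\<lambda>a. x (a, m))"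
  have "mat r r (\<lambda>(a, b). chart x (a, pv[i := m] ! b)) = replace_col (1\<^sub>m r) ?v i"
    using length_pv distinct_pv i
    by (intro eq_matI) (auto simp: chart_def nth_eq_iff_index_eq replace_col_def nth_list_update)
  then have "det (mat r r (\<lambda>(a, b). chart x (a, pv[i := m] ! b))) = ?v $ i * det (1\<^sub>m r)"
    using cramer_lemma_mat[of "1\<^sub>m r" r ?v i] i by simp
  moreover have "set (pv[i := m]) \<subseteq> monoms {..n} d"
    using set_update_subset_insert[of pv i m] pv_monoms i by blast
  ultimately show ?thesis using i length_pv by (simp add: pluecker_row_forms)
qed

lemma full_rank_if_pluecker: "pluecker (row_forms N) ms \<noteq> 0 \<Longrightarrow> full_rank N"
  using pluecker_nonzero_imp_independent by (simp add: full_rank_def)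

lemma full_rank_chart: "full_rank (chart x)"
  using full_rank_if_pluecker[of "chart x" pv] pluecker_chart_pv by simp

text \<open>Equal row spaces have proportional Pluecker coordinates; the factor is 1 because both
  coordinates at \<open>pv\<close> are 1.\<close>

lemma chart_inj:
  assumes "rowspan (chart x) = rowspan (chart y)" "k \<in> free_entries"
  shows "x k = y k"
proof -
  have "set (row_forms (chart x)) \<subseteq> rowspan (chart y)"
    using assms(1) cpoly.span_superset by blast
  then obtain c where c: "\<And>ms. pluecker (row_forms (chart x)) ms = c * pluecker (row_forms (chart
    y)) ms"
    using pluecker_span[of "row_forms (chart x)" "row_forms (chart y)"] by auto
  have "c = 1" using c[of pv] by (simp add: pluecker_chart_pv)
  then show ?thesis
    using c[of "pv[fst k := snd k]"] pluecker_chart_update[of "fst k" "snd k"] assms(2) by simp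
qed

text \<open>On the chart the coordinates are themselves Pluecker coordinates, so every polynomial function
  on it can be made homogeneous by multiplying with powers of the coordinate \<open>pv\<close>,
  which is 1 there.\<close>

lemma homogenize:
  assumes "f \<in> polyfuns free_entries"
  shows "\<exists>k. \<exists>F\<in>forms (pluecker_index n d r) k. \<forall>x. eval_poly F (pluecker (row_forms (chart x))) =
    f x"
  using assms
proof (induction rule: polyfuns.induct)
  case (const c)
  show ?case
    by (intro exI[of _ 0] bexI[of _ "Poly_Mapping.single 0 c"] forms_single monoms_0)
       (simp add: eval_poly_single eval_monom_def)
next
  case (var k)
  obtain i m where k: "k = (i, m)" by fastforce
  have im: "i < r" "m \<in> monoms {..n} d" "(i, m) \<in> free_entries" using var k by (auto simp:
    free_entries_def)
  have "pv[i := m] \<in> pluecker_index n d r"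
    using set_update_subset_insert[of pv i m] pv_monoms im length_pv by (auto simp:
      pluecker_index_def)
  then have "Poly_Mapping.single (Poly_Mapping.single (pv[i := m]) 1) 1 \<in> forms (pluecker_index n
    d r) 1"
    by (intro forms_single monoms_single)
  then show ?case
    by (intro exI bexI) (auto simp: eval_poly_single eval_monom_def k pluecker_chart_update[OF
      im(3)])
next
  case (add f g)
  then obtain k F l G where F: "F \<in> forms (pluecker_index n d r) k" "\<And>x. eval_poly F (pluecker
    (row_forms (chart x))) = f x"
    and G: "G \<in> forms (pluecker_index n d r) l" "\<And>x. eval_poly G (pluecker (row_forms (chart x)))
      = g x" by blast
  define P :: "nat monom list cpoly" where "P = Poly_Mapping.single (Poly_Mapping.single pv 1) 1"
  have P: "P ^ a \<in> forms (pluecker_index n d r) a" for a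
    using forms_power[of P "pluecker_index n d r" 1 a] forms_single[OF monoms_single[OF
      pv_in_index], of 1 1]
    by (simp add: P_def)
  have eP: "eval_poly P (pluecker (row_forms (chart x))) = 1" for x
    by (simp add: P_def eval_poly_single eval_monom_def pluecker_chart_pv)
  have "F * P ^ l + G * P ^ k \<in> forms (pluecker_index n d r) (k + l)"
    using forms_mult[OF F(1) P[of l]] forms_mult[OF G(1) P[of k]] by (intro forms_add) (auto simp:
      add.commute)
  then show ?case
    by (intro exI bexI) (auto simp: eval_poly_add eval_poly_mult eval_poly_power eP F G)
next
  case (mult f g)
  then obtain k F l G where F: "F \<in> forms (pluecker_index n d r) k" "\<And>x. eval_poly F (pluecker
    (row_forms (chart x))) = f x"
    and G: "G \<in> forms (pluecker_index n d r) l" "\<And>x. eval_poly G (pluecker (row_forms (chart x)))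
      = g x" by blast
  show ?case
    by (intro exI bexI[of _ "F * G"], rule allI)
       (auto simp: eval_poly_mult F G intro: forms_mult[OF F(1) G(1)])
qed

text \<open>Multiplication by the inverse of the pivot submatrix brings the basis into reduced
  form.\<close>

lemma chart_surj:
  assumes L: "L \<in> Grass n d r" and bs: "ordered_basis bs L" and nz: "pluecker bs pv \<noteq> 0"
  obtains x where "L = rowspan (chart x)"
proof -
  have l: "length bs = r" and s: "set bs \<subseteq> Sd n d" using Grass_ordered_basis[OF L bs] by auto
  let ?B = "mat r r (\<lambda>(i, j). Poly_Mapping.lookup (bs ! i) (pv ! j))"
  have dB: "det ?B \<noteq> 0" using nz by (simp add: pluecker_def l)
  have "?B \<in> Units (ring_mat TYPE(complex) r ())"
    by (rule det_non_zero_imp_unit[OF _ dB]) simp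
  then obtain P where P: "P \<in> carrier_mat r r" "P * ?B = 1\<^sub>m r"
    by (auto simp: Units_def ring_mat_def)
  define b where "b i = (\<Sum>j<r. scale_poly (P $$ (i, j)) (bs ! j))" for i
  define x where "x = (\<lambda>(i, m). Poly_Mapping.lookup (b i) m)"
  have bSd: "b i \<in> Sd n d" for i
    unfolding b_def using s l subspace_forms
    by (auto simp: Sd_def intro!: cpoly.subspace_sum cpoly.subspace_scale)
  have row_forms: "row_forms (chart x) ! i = b i" if i: "i < r" for i
  proof (rule poly_mapping_eqI)
    fix m
    show "Poly_Mapping.lookup (row_forms (chart x) ! i) m = Poly_Mapping.lookup (b i) m"
    proof (cases "m \<in> set pv")
      case True
      then obtain k where k: "k < r" "m = pv ! k" using length_pv by (auto simp: in_set_conv_nth)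
      have "Poly_Mapping.lookup (b i) m = (P * ?B) $$ (i, k)"
        using i k P(1) by (simp add: b_def lookup_sum lookup_scale_poly scalar_prod_def
          lessThan_atLeast0)
      also have "\<dots> = (if i = k then 1 else 0)" using P(2) i k by simp
      also have "\<dots> = Poly_Mapping.lookup (row_forms (chart x) ! i) m"
        using True pv_monoms i k length_pv distinct_pv
        by (auto simp: lookup_row_forms chart_def nth_eq_iff_index_eq)
      finally show ?thesis by simp
    next
      case False
      then show ?thesis using i bSd[of i]
        by (auto simp: lookup_row_forms chart_def x_def Sd_def forms_def in_keys_iff)
    qed
  qed
  have "set (row_forms (chart x)) \<subseteq> cpoly.span (set bs)"
  proof
    fix y assume "y \<in> set (row_forms (chart x))"
    then obtain i where "i < r" "y = b i" using row_forms by (auto simp: in_set_conv_nth)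
    then show "y \<in> cpoly.span (set bs)" unfolding b_def
      using l by (auto intro!: cpoly.span_sum cpoly.span_scale intro: cpoly.span_base)
  qed
  then have "rowspan (chart x) = cpoly.span (set bs)"
    using full_rank_chart l by (intro span_eq_if_length_le) (auto simp: full_rank_def)
  then show ?thesis using that[of x] bs by (simp add: ordered_basis_def)
qed

lemma openin_chart:
  assumes "f \<in> polyfuns free_entries"
  shows "openin X {rowspan (chart x) | x. f x \<noteq> 0}"
proof -
  obtain k F where F: "F \<in> forms (pluecker_index n d r) k" "\<And>x. eval_poly F (pluecker (row_forms
    (chart x))) = f x"
    using homogenize[OF assms] by blast
  \<comment> \<open>The factor \<open>P\<close> confines the nonvanishing locus to the chart, where
    \<open>F\<close> represents \<open>f\<close>.\<close>
  define P :: "nat monom list cpoly" where "P = Poly_Mapping.single (Poly_Mapping.single pv 1) 1"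
  have eP: "eval_poly P (pluecker bs) = pluecker bs pv" for bs
    by (simp add: P_def eval_poly_single eval_monom_def)
  have P: "P \<in> forms (pluecker_index n d r) 1"
    unfolding P_def by (intro forms_single monoms_single pv_in_index)
  have "{rowspan (chart x) | x. f x \<noteq> 0} = nonvanishing n d r (F * P)"
  proof (intro equalityI subsetI)
    fix L assume "L \<in> {rowspan (chart x) | x. f x \<noteq> 0}"
    then show "L \<in> nonvanishing n d r (F * P)"
      using rowspan_in_Grass[OF full_rank_chart] ordered_basis_rows[OF full_rank_chart] F(2)
      by (auto simp: nonvanishing_def eval_poly_mult eP pluecker_chart_pv intro!: exI)
  next
    fix L assume "L \<in> nonvanishing n d r (F * P)"
    then obtain bs where L: "L \<in> Grass n d r" and bs: "ordered_basis bs L"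
      and nz: "eval_poly F (pluecker bs) \<noteq> 0" "pluecker bs pv \<noteq> 0"
      by (auto simp: nonvanishing_def eval_poly_mult eP)
    obtain x where x: "L = rowspan (chart x)" using chart_surj[OF L bs nz(2)] .
    have "eval_poly F (pluecker (row_forms (chart x))) \<noteq> 0"
    proof (rule eval_pluecker_basis[OF F(1) _ _ nz(1)])
      show "set bs \<subseteq> rowspan (chart x)"
        using bs x cpoly.span_superset unfolding ordered_basis_def by blast
      show "length bs = length (row_forms (chart x))" using Grass_ordered_basis[OF L bs] by simp
    qed
    then show "L \<in> {rowspan (chart x) | x. f x \<noteq> 0}" using x F(2) by auto
  qed
  then show ?thesis using openin_nonvanishing[OF forms_mult[OF F(1) P]] by simp
qed

text \<open>Pulled back to the parameters, an open set that meets the image contains the locus where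
  some nonzero polynomial does not vanish, and two such loci meet. Multiplying by \<open>e\<close>
  keeps the parameters where the rank is full.\<close>

lemma irreducible_closed_image:
  assumes P: "\<And>k. k \<in> entries \<Longrightarrow> (\<lambda>p. P p k) \<in> polyfuns I"
    and e: "e \<in> polyfuns I" "e p0 \<noteq> 0" "\<And>p. e p \<noteq> 0 \<Longrightarrow> full_rank (P p)"
  shows "irreducible_closed X (X closure_of {rowspan (P p) | p. e p \<noteq> 0})"
proof (rule irreducible_closed_closure_of)
  show "{rowspan (P p) | p. e p \<noteq> 0} \<subseteq> topspace X"
    using e(3) rowspan_in_Grass topspace_Grass by auto
  show "{rowspan (P p) | p. e p \<noteq> 0} \<noteq> {}" using e(2) by blast
  fix U V assume UV: "openin X U" "openin X V" "U \<inter> {rowspan (P p) | p. e p \<noteq> 0} \<noteq> {}"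
    "V \<inter> {rowspan (P p) | p. e p \<noteq> 0} \<noteq> {}"
  have *: "\<exists>h\<in>polyfuns I. (\<exists>p. h p \<noteq> 0) \<and> (\<forall>p. h p \<noteq> 0 \<longrightarrow> e p \<noteq> 0 \<and> rowspan (P p) \<in> W)"
    if W: "openin X W" "W \<inter> {rowspan (P p) | p. e p \<noteq> 0} \<noteq> {}" for W
  proof -
    obtain p where p: "e p \<noteq> 0" "rowspan (P p) \<in> W" using W(2) by blast
    obtain f where f: "f \<in> polyfuns entries" "f (P p) \<noteq> 0"
      "\<forall>N'. full_rank N' \<longrightarrow> f N' \<noteq> 0 \<longrightarrow> rowspan N' \<in> W"
      using openin_rowspan[OF W(1) e(3)[OF p(1)] p(2)] by blast
    have "(\<lambda>p. f (P p)) \<in> polyfuns I" by (rule polyfuns_comp[OF f(1) P])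
    then show ?thesis using f p e
      by (intro bexI[of _ "\<lambda>p. f (P p) * e p"]) (auto intro: polyfuns.mult)
  qed
  obtain h where h: "h \<in> polyfuns I" "\<exists>p. h p \<noteq> 0" "\<forall>p. h p \<noteq> 0 \<longrightarrow> e p \<noteq> 0 \<and> rowspan (P p) \<in> U"
    using *[OF UV(1,3)] by blast
  obtain g where g: "g \<in> polyfuns I" "\<exists>p. g p \<noteq> 0" "\<forall>p. g p \<noteq> 0 \<longrightarrow> e p \<noteq> 0 \<and> rowspan (P p) \<in> V"
    using *[OF UV(2,4)] by blast
  obtain a b where "h a \<noteq> 0" "g b \<noteq> 0" using h(2) g(2) by blast
  then obtain p where "h p \<noteq> 0" "g p \<noteq> 0" using polyfuns_mult_nonzero[OF h(1) g(1)] by blast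
  then show "U \<inter> V \<inter> {rowspan (P p) | p. e p \<noteq> 0} \<noteq> {}" using h(3) g(3) by blast
qed

text \<open>The matrices with nonzero minor at \<open>pv\<close> parametrize the chart. It is dense
  because a neighbourhood of any subspace pulls back to a nonzero polynomial, which is nonzero
  together with \<open>e\<close> at some matrix.\<close>

lemma irreducible_closed_Grass: "irreducible_closed X (Grass n d r)"
proof -
  define e where "e = (\<lambda>N. pluecker (row_forms N) pv)"
  let ?S = "{rowspan N | N. e N \<noteq> 0}"
  have e: "e \<in> polyfuns entries"
    unfolding e_def by (rule polyfuns_pluecker_row_forms[OF pv_in_index])
  have e0: "e (chart (\<lambda>_. 0)) \<noteq> 0" by (simp add: e_def pluecker_chart_pv)
  have full: "full_rank N" if "e N \<noteq> 0" for N using that full_rank_if_pluecker by (simp add: e_def)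
  have "irreducible_closed X (X closure_of ?S)"
  proof (rule irreducible_closed_image[of "\<lambda>N. N" entries e, OF _ e e0])
    show "(\<lambda>N. N k) \<in> polyfuns entries" if "k \<in> entries" for k using that by (rule polyfuns.var)
  qed (rule full)
  moreover have "X closure_of ?S = Grass n d r"
  proof
    show "X closure_of ?S \<subseteq> Grass n d r" using closure_of_subset_topspace[of X] topspace_Grass by
      simp
    show "Grass n d r \<subseteq> X closure_of ?S"
    proof
      fix L assume L: "L \<in> Grass n d r"
      obtain N where N: "full_rank N" "rowspan N = L" using Grass_obtain_rows[OF L] .
      have "\<exists>L'. L' \<in> ?S \<and> L' \<in> U" if U: "L \<in> U" "openin X U" for U
      proof -
        obtain f where f: "f \<in> polyfuns entries" "f N \<noteq> 0"
          "\<forall>N'. full_rank N' \<longrightarrow> f N' \<noteq> 0 \<longrightarrow> rowspan N' \<in> U"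
          using openin_rowspan[OF U(2) N(1)] N(2) U(1) by auto
        have "\<exists>N'. f N' \<noteq> 0 \<and> e N' \<noteq> 0"
          by (rule polyfuns_mult_nonzero[where a = N and b = "chart (\<lambda>_. 0)"]) (fact f(1) e f(2)
            e0)+
        then obtain N' where "f N' \<noteq> 0" "e N' \<noteq> 0" by (elim exE conjE)
        then show ?thesis using f(3) full[of N'] by auto
      qed
      then show "L \<in> X closure_of ?S" using L by (auto simp: in_closure_of topspace_Grass)
    qed
  qed
  ultimately show ?thesis by simp
qed

lemma closedin_subset_Grass: "closedin X C \<Longrightarrow> C \<subseteq> Grass n d r"
  using closedin_subset topspace_Grass by blast

text \<open>Everything is moved into the chart, where \<open>no_irreducible_between\<close> applies:
  irreducibility of the Grassmannian gives a chart point outside \<open>C\<close>, hence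
  \<open>h\<close>; irreducibility of \<open>C\<close> gives a chart point of \<open>C\<close>
  outside \<open>Z\<close>, hence \<open>g\<close> and the contradiction.\<close>

lemma irreducible_above_hypersurface:
  assumes Z: "closedin X Z" and C: "irreducible_closed X C" and ZC: "Z \<subset> C" and t: "t \<in>
    free_entries"
    and dom: "\<And>f x. f \<in> polyfuns (free_entries - {t}) \<Longrightarrow>
        (\<And>x. rowspan (chart x) \<in> Z \<Longrightarrow> f x = 0) \<Longrightarrow> f x = 0"
  shows "C = Grass n d r"
proof (rule ccontr)
  assume "C \<noteq> Grass n d r"
  have cC: "closedin X C" using C by (simp add: irreducible_closed_def)
  have "C \<subseteq> Grass n d r" by (rule closedin_subset_Grass[OF cC])
  \<comment> \<open>The whole chart, in the form that \<open>openin_chart\<close> takes for the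
    constant function 1.\<close>
  define U0 where "U0 = {rowspan (chart x) | x. (1::complex) \<noteq> 0}"
  have U0: "openin X U0"
    unfolding U0_def using openin_chart[of "\<lambda>_. 1"] polyfuns.const by blast
  \<comment> \<open>If \<open>Z\<close> missed the chart, \<open>dom\<close> would force the
    constant 1 to vanish.\<close>
  have "\<exists>x0. rowspan (chart x0) \<in> Z"
  proof (rule ccontr)
    assume n: "\<nexists>x0. rowspan (chart x0) \<in> Z"
    have "(1::complex) = 0"
      by (rule dom[of "\<lambda>_. 1"]) (use n polyfuns.const in blast)+
    then show False by simp
  qed
  then obtain x0 where x0: "rowspan (chart x0) \<in> Z" ..
  have comp: "(\<lambda>x. f (chart x)) \<in> polyfuns free_entries" if "f \<in> polyfuns entries" for f
    by (rule polyfuns_comp[OF that polyfuns_chart])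
  have outside: "\<exists>h\<in>polyfuns free_entries. h y \<noteq> 0 \<and> (\<forall>x. rowspan (chart x) \<in> W \<longrightarrow> h x = 0)"
    if W: "closedin X W" "rowspan (chart y) \<notin> W" for W y
  proof -
    have "openin X (topspace X - W)" using W(1) by blast
    moreover have "rowspan (chart y) \<in> topspace X - W"
      using W(2) rowspan_in_Grass[OF full_rank_chart] topspace_Grass by blast
    ultimately obtain f where "f \<in> polyfuns entries" "f (chart y) \<noteq> 0"
      "\<forall>N'. full_rank N' \<longrightarrow> f N' \<noteq> 0 \<longrightarrow> rowspan N' \<in> topspace X - W"
      using openin_rowspan[OF _ full_rank_chart] by blast
    then show ?thesis using comp full_rank_chart by (intro bexI[of _ "\<lambda>x. f (chart x)"]) auto
  qed
  have "(topspace X - C) \<inter> U0 \<inter> Grass n d r \<noteq> {}"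
  proof (rule irreducible_closed_Int[OF irreducible_closed_Grass _ _ U0])
    show "(topspace X - C) \<inter> Grass n d r \<noteq> {}"
      using topspace_Grass \<open>C \<subseteq> Grass n d r\<close> \<open>C \<noteq> Grass n d r\<close> by blast
    show "U0 \<inter> Grass n d r \<noteq> {}"
      using x0 closedin_subset_Grass[OF Z] by (auto simp: U0_def)
  qed (use cC in blast)
  then obtain x1 where x1: "rowspan (chart x1) \<notin> C" by (auto simp: U0_def)
  obtain h where h: "h \<in> polyfuns free_entries" "h x1 \<noteq> 0" "\<forall>x. rowspan (chart x) \<in> C \<longrightarrow> h x = 0"
    using outside[OF cC x1] by blast
  have "(topspace X - Z) \<inter> U0 \<inter> C \<noteq> {}"
  proof (rule irreducible_closed_Int[OF C _ _ U0])
    show "(topspace X - Z) \<inter> C \<noteq> {}" using ZC topspace_Grass \<open>C \<subseteq> Grass n d r\<close> by blast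
    show "U0 \<inter> C \<noteq> {}" using x0 ZC by (auto simp: U0_def)
  qed (use Z in blast)
  then obtain y where y: "rowspan (chart y) \<notin> Z" "rowspan (chart y) \<in> C" by (auto simp: U0_def)
  obtain g where g: "g \<in> polyfuns free_entries" "g y \<noteq> 0" "\<forall>x. rowspan (chart x) \<in> Z \<longrightarrow> g x = 0"
    using outside[OF Z y(1)] by blast
  have "g y = 0"
  proof (rule no_irreducible_between[OF t, where Z = "{x. rowspan (chart x) \<in> Z}"
        and C = "{x. rowspan (chart x) \<in> C}" and h = h and ?x0.0 = x1 and g = g and y = y])
    fix f g assume fg: "f \<in> polyfuns free_entries" "g \<in> polyfuns free_entries"
      and 0: "\<And>x. x \<in> {x. rowspan (chart x) \<in> C} \<Longrightarrow> f x * g x = 0"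
    show "(\<forall>x\<in>{x. rowspan (chart x) \<in> C}. f x = 0) \<or> (\<forall>x\<in>{x. rowspan (chart x) \<in> C}. g x = 0)"
    proof (rule ccontr)
      assume "\<not> ?thesis"
      then obtain a b where ab: "rowspan (chart a) \<in> C" "f a \<noteq> 0" "rowspan (chart b) \<in> C" "g b \<noteq> 0"
        by blast
      have "{rowspan (chart x) | x. f x \<noteq> 0} \<inter> {rowspan (chart x) | x. g x \<noteq> 0} \<inter> C \<noteq> {}"
        by (rule irreducible_closed_Int[OF C openin_chart[OF fg(1)] _ openin_chart[OF fg(2)]])
           (use ab in blast)+
      \<comment> \<open>The two open sets share a subspace, described by \<open>u\<close> and by
        \<open>v\<close>; these agree on the free entries, so \<open>f u * g u\<close> is
        nonzero.\<close>
      then obtain u v where uv: "rowspan (chart u) = rowspan (chart v)" "rowspan (chart u) \<in> C"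
        "f u \<noteq> 0" "g v \<noteq> 0" by auto
      have "g u = g v" by (rule polyfuns_cong[OF fg(2)]) (rule chart_inj[OF uv(1)])
      then show False using 0[of u] uv by simp
    qed
  next
    fix f x assume f: "f \<in> polyfuns (free_entries - {t})" "\<And>x. x \<in> {x. rowspan (chart x) \<in> Z} \<Longrightarrow> f
      x = 0"
    show "f x = 0" by (rule dom[OF f(1)]) (use f(2) in simp)
  qed (use ZC h g y in auto)
  then show False using g(2) by simp
qed

end

section \<open>Quadratic monomials and squares of linear forms\<close>

definition qm :: "nat \<Rightarrow> nat \<Rightarrow> nat monom" where
  "qm a b = Poly_Mapping.single a 1 + Poly_Mapping.single b 1"

lemma lookup_qm: "Poly_Mapping.lookup (qm a b) i = (if a = i then 1 else 0) + (if b = i then 1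
  else 0)"
  by (simp add: qm_def lookup_add lookup_single when_def)

lemma qm_commute: "qm a b = qm b a"
  by (simp add: qm_def add.commute)

lemma qm_eq_iff: "qm a b = qm c e \<longleftrightarrow> a = c \<and> b = e \<or> a = e \<and> b = c"
proof
  assume eq: "qm a b = qm c e"
  have *: "(if a = i then 1 else 0) + (if b = i then 1 else 0)
      = (if c = i then 1 else 0) + (if e = i then 1 else 0 :: nat)" for i
    unfolding lookup_qm[symmetric] eq ..
  show "a = c \<and> b = e \<or> a = e \<and> b = c"
  proof (cases "a = c")
    case True
    then show ?thesis using *[of b] by (simp split: if_splits)
  next
    case False
    then have "e = a" using *[of a] by (simp split: if_splits)
    then show ?thesis using *[of b] by (simp split: if_splits)
  qed
qed (auto simp: qm_commute)

lemma monoms_SucE: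
  assumes "m \<in> monoms I (Suc d)"
  obtains i m' where "i \<in> I" "m' \<in> monoms I d" "m = Poly_Mapping.single i 1 + m'"
proof -
  have m: "Poly_Mapping.keys m \<subseteq> I" "mdegree m = Suc d" using assms by (auto simp: monoms_def)
  then have "Poly_Mapping.keys m \<noteq> {}" by (auto simp: mdegree_def)
  then obtain i where i: "i \<in> Poly_Mapping.keys m" by blast
  define m' where "m' = m - Poly_Mapping.single i 1"
  have eq: "m = Poly_Mapping.single i 1 + m'"
    using i by (intro poly_mapping_eqI)
      (auto simp: m'_def lookup_add lookup_minus lookup_single when_def in_keys_iff)
  have "mdegree m' = d" using m(2) unfolding eq by (simp add: mdegree_add mdegree_single)
  moreover have "Poly_Mapping.keys m' \<subseteq> Poly_Mapping.keys m"
    by (auto simp: m'_def in_keys_iff lookup_minus)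
  ultimately show ?thesis using that[of i m'] i m(1) eq by (auto simp: monoms_def)
qed

lemma monoms_0_eq: "monoms I 0 = {0}"
proof -
  have "m = 0" if "mdegree m = 0" for m :: "'a monom"
    using that by (intro poly_mapping_eqI) (auto simp: mdegree_def in_keys_iff)
  then show ?thesis using monoms_0 by (auto simp: monoms_def)
qed

lemma monoms_1E:
  assumes "m \<in> monoms I 1"
  obtains i where "i \<in> I" "m = Poly_Mapping.single i 1"
proof -
  have "m \<in> monoms I (Suc 0)" using assms by simp
  then obtain i m' where "i \<in> I" "m' \<in> monoms I 0" "m = Poly_Mapping.single i 1 + m'"
    by (rule monoms_SucE)
  then show ?thesis using that[of i] by (simp add: monoms_0_eq)
qed

lemma monoms_2: "monoms {..n} 2 = (\<lambda>(a, b). qm a b) ` {(a, b). a \<le> b \<and> b \<le> n}"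
proof (intro equalityI subsetI)
  fix m assume m: "m \<in> monoms {..n} 2"
  then obtain a m' where a: "a \<le> n" "m' \<in> monoms {..n} 1" "m = Poly_Mapping.single a 1 + m'"
    using monoms_SucE[of m "{..n}" 1] by (auto simp: numeral_2_eq_2)
  obtain b where "b \<le> n" "m' = Poly_Mapping.single b 1" using a(2) by (elim monoms_1E) simp
  then have "m = qm a b" "m = qm b a" "b \<le> n" using a qm_commute by (auto simp: qm_def)
  then show "m \<in> (\<lambda>(a, b). qm a b) ` {(a, b). a \<le> b \<and> b \<le> n}"
    using a(1) by (intro image_eqI[of _ _ "if a \<le> b then (a, b) else (b, a)"]) auto
next
  fix m assume "m \<in> (\<lambda>(a, b). qm a b) ` {(a, b). a \<le> b \<and> b \<le> n}"
  then show "m \<in> monoms {..n} 2"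
    using monoms_add[OF monoms_single monoms_single, of _ "{..n}" _ 1 1]
    by (auto simp: qm_def numeral_2_eq_2)
qed

lemma qm_in_monoms: "a \<le> n \<Longrightarrow> b \<le> n \<Longrightarrow> qm a b \<in> monoms {..n} 2"
  using monoms_add[OF monoms_single monoms_single, of a "{..n}" b 1 1]
  by (auto simp: qm_def numeral_2_eq_2)

definition lin_form :: "nat \<Rightarrow> (nat \<Rightarrow> complex) \<Rightarrow> nat cpoly" where
  "lin_form n c = (\<Sum>a\<le>n. Poly_Mapping.single (Poly_Mapping.single a 1) (c a))"

lemma lin_form_in_Sd: "lin_form n c \<in> Sd n 1"
  unfolding lin_form_def Sd_def by (intro forms_sum forms_single monoms_single) simp

lemma Sd_1_lin_form:
  assumes "q \<in> Sd n 1"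
  shows "q = lin_form n (\<lambda>a. Poly_Mapping.lookup q (Poly_Mapping.single a 1))"
proof (rule poly_mapping_eqI)
  fix m
  show "Poly_Mapping.lookup q m =
    Poly_Mapping.lookup (lin_form n (\<lambda>a. Poly_Mapping.lookup q (Poly_Mapping.single a 1))) m"
  proof (cases "m \<in> monoms {..n} 1")
    case True
    then obtain i where i: "i \<le> n" "m = Poly_Mapping.single i 1" by (elim monoms_1E) simp
    have inj: "Poly_Mapping.single a (Suc 0) = Poly_Mapping.single i (Suc 0) \<longleftrightarrow> a = i" for a
    proof
      assume h: "Poly_Mapping.single a (Suc 0) = Poly_Mapping.single i (Suc 0)"
      have "Poly_Mapping.lookup (Poly_Mapping.single a (Suc 0)) a = Poly_Mapping.lookup
        (Poly_Mapping.single i (Suc 0)) a"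
        unfolding h ..
      then show "a = i" by (simp add: lookup_single when_def split: if_splits)
    qed simp
    show ?thesis using i
      by (simp add: lin_form_def lookup_sum lookup_single when_def inj sum.delta)
  next
    case False
    have "p \<in> Sd n 1 \<Longrightarrow> Poly_Mapping.lookup p m = 0" for p
      using False by (auto simp: Sd_def forms_def in_keys_iff)
    then show ?thesis using assms lin_form_in_Sd by simp
  qed
qed

lemma lookup_lin_form_square:
  assumes "a \<le> n" "b \<le> n"
  shows "Poly_Mapping.lookup (lin_form n c ^ 2) (qm a b) = (if a = b then 1 else 2) * c a * c b"
proof -
  have "lin_form n c ^ 2 = (\<Sum>(i, j)\<in>{..n} \<times> {..n}. Poly_Mapping.single (qm i j) (c i * c j))"
    by (simp add: lin_form_def power2_eq_square sum_product mult_single qm_def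
      sum.cartesian_product)
  then have "Poly_Mapping.lookup (lin_form n c ^ 2) (qm a b)
    = (\<Sum>(i, j)\<in>{..n} \<times> {..n}. c i * c j when qm i j = qm a b)"
    by (simp add: lookup_sum lookup_single split_def)
  also have "\<dots> = (\<Sum>(i, j)\<in>{(a, b), (b, a)}. c i * c j when qm i j = qm a b)"
    using assms by (intro sum.mono_neutral_right) (auto simp: qm_eq_iff)
  also have "\<dots> = (if a = b then 1 else 2) * c a * c b"
    by (simp add: qm_eq_iff)
  finally show ?thesis .
qed

section \<open>The Koszul flattening\<close>

text \<open>The coefficient of \<open>x\<^sub>a x\<^sub>b\<close> with \<open>a \<noteq> b\<close> is split evenly between two matrix entries.\<close>

definition gram :: "(nat \<times> nat monom \<Rightarrow> complex) \<Rightarrow> nat \<Rightarrow> nat \<Rightarrow> nat \<Rightarrow> complex" where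
  "gram N k a b = N (k, qm a b) / (if a = b then 1 else 2)"

text \<open>With \<open>A\<^sub>k = gram N k\<close>, the matrix in \<open>4 \<times> 4\<close> blocks is
  \<open>((0, A\<^sub>2, -A\<^sub>1), (-A\<^sub>2, 0, A\<^sub>0), (A\<^sub>1, -A\<^sub>0, 0))\<close>.\<close>

definition koszul_entry :: "(nat \<times> nat monom \<Rightarrow> complex) \<Rightarrow> nat \<Rightarrow> nat \<Rightarrow> complex" where
  "koszul_entry N i j =
     (if j div 4 = (i div 4 + 1) mod 3 then gram N ((i div 4 + 2) mod 3) (i mod 4) (j mod 4)
      else if j div 4 = (i div 4 + 2) mod 3 then - gram N ((i div 4 + 1) mod 3) (i mod 4) (j mod 4)
      else 0)"

definition koszul :: "(nat \<times> nat monom \<Rightarrow> complex) \<Rightarrow> complex mat" where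
  "koszul N = mat 12 12 (\<lambda>(i, j). koszul_entry N i j)"

lemma sum_blocks: "(\<Sum>j<12. f j) = (\<Sum>l<3. \<Sum>b<4. f (4 * l + b :: nat) :: complex)"
  by (simp add: eval_nat_numeral)

lemma lessThan_12_cases:
  assumes "i < (12::nat)"
  obtains k a where "k < 3" "a < 4" "i = 4 * k + a"
  using that[of "i div 4" "i mod 4"] assms by auto

lemma less_3_cases: "k < (3::nat) \<longleftrightarrow> k = 0 \<or> k = 1 \<or> k = 2"
  by auto

lemma sum_cyclic_3:
  fixes F :: "nat \<Rightarrow> complex"
  assumes "k < 3"
  shows "(\<Sum>l<3. F l) = F k + F ((k + 1) mod 3) + F ((k + 2) mod 3)"
proof -
  have "{..<3::nat} = {0, 1, 2}" by auto
  then show ?thesis using assms unfolding less_3_cases by (elim disjE) (simp_all add: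
    numeral_2_eq_2)
qed

lemma cyclic_3_distinct:
  assumes "k < (3::nat)"
  shows "(k + 1) mod 3 \<noteq> k" "(k + 2) mod 3 \<noteq> k" "(k + 1) mod 3 \<noteq> (k + 2) mod 3"
  using assms by presburger+

lemma cyclic_3_cases:
  assumes "l < (3::nat)" "i < 3"
  shows "i = l \<or> i = (l + 1) mod 3 \<or> i = (l + 2) mod 3"
  using assms unfolding less_3_cases by auto

text \<open>Block \<open>k\<close> is, up to sign, component \<open>k\<close> of the cross product
  of the Gram triple with the triple of blocks of \<open>v\<close>; cyclic indices treat the three
  blocks at once.\<close>

lemma koszul_mult:
  assumes "k < 3" "a < 4" "v \<in> carrier_vec 12"
  shows "(koszul N *\<^sub>v v) $ (4 * k + a) =
    (\<Sum>b<4. gram N ((k + 2) mod 3) a b * v $ (4 * ((k + 1) mod 3) + b)) -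
    (\<Sum>b<4. gram N ((k + 1) mod 3) a b * v $ (4 * ((k + 2) mod 3) + b))"
proof -
  have d: "(4 * l + b) div 4 = l" "(4 * l + b) mod 4 = b" if "b < 4" for l b :: nat
    using that by auto
  have i: "4 * k + a < 12" using assms by auto
  have "(koszul N *\<^sub>v v) $ (4 * k + a) = (\<Sum>j<12. koszul_entry N (4 * k + a) j * v $ j)"
    using i assms(3) by (simp add: koszul_def scalar_prod_def lessThan_atLeast0)
  also have "\<dots> = (\<Sum>l<3. \<Sum>b<4. koszul_entry N (4 * k + a) (4 * l + b) * v $ (4 * l + b))"
    by (rule sum_blocks)
  also have "\<dots> = (\<Sum>l<3. \<Sum>b<4. (if l = (k + 1) mod 3 then gram N ((k + 2) mod 3) a b
      else if l = (k + 2) mod 3 then - gram N ((k + 1) mod 3) a b else 0) * v $ (4 * l + b))"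
    using assms(2) by (intro sum.cong refl) (simp add: koszul_entry_def d)
  also have "\<dots> = (\<Sum>b<4. gram N ((k + 2) mod 3) a b * v $ (4 * ((k + 1) mod 3) + b)) -
    (\<Sum>b<4. gram N ((k + 1) mod 3) a b * v $ (4 * ((k + 2) mod 3) + b))"
    unfolding sum_cyclic_3[OF assms(1)]
    using cyclic_3_distinct[OF assms(1)] not_sym[OF cyclic_3_distinct(1)[OF assms(1)]]
      not_sym[OF cyclic_3_distinct(2)[OF assms(1)]] not_sym[OF cyclic_3_distinct(3)[OF assms(1)]]
    by (simp add: sum_negf)
  finally show ?thesis .
qed

lemma det_koszul_eq_0_iff:
  "det (koszul N) = 0 \<longleftrightarrow> (\<exists>v. v \<in> carrier_vec 12 \<and> v \<noteq> 0\<^sub>v 12 \<and> koszul N *\<^sub>v v = 0\<^sub>v 12)"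
  by (rule det_0_iff_vec_prod_zero_field) (simp add: koszul_def)

text \<open>\<open>y\<close> is parallel to \<open>v\<close> when three 2 x 2 minors vanish. If
  \<open>v l\<close> is nonzero, the two minors involving the index \<open>l\<close> imply the third
  after cancelling \<open>v l\<close>; these two are the conditions given by \<alpha> and \<beta>.
  For \<open>v = 0\<close> all minors vanish.\<close>

lemma parallel_conditions:
  fixes v :: "nat \<Rightarrow> complex"
  shows "\<exists>\<alpha> \<beta>. \<forall>y. (\<Sum>k<3. \<alpha> k * y k) = 0 \<longrightarrow> (\<Sum>k<3. \<beta> k * y k) = 0 \<longrightarrow>
    (\<forall>k<3. v ((k + 2) mod 3) * y ((k + 1) mod 3) = v ((k + 1) mod 3) * y ((k + 2) mod 3))"
proof (cases "\<exists>l<3. v l \<noteq> 0")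
  case False
  then have "v (m mod 3) = 0" for m by simp
  then show ?thesis by simp
next
  case True
  then obtain l where l: "l < 3" "v l \<noteq> 0" by blast
  have goal: "v ((k + 2) mod 3) * y ((k + 1) mod 3) = v ((k + 1) mod 3) * y ((k + 2) mod 3)"
    if k: "k < 3" and par: "\<And>i. i < 3 \<Longrightarrow> v l * y i = v i * y l" for y :: "nat \<Rightarrow> complex" and k
  proof -
    let ?i = "(k + 1) mod 3" and ?j = "(k + 2) mod 3"
    have "v l * (v ?j * y ?i) = v ?j * (v l * y ?i)" by (rule mult.left_commute)
    also have "\<dots> = v ?i * (v l * y ?j)" using par[of ?i] par[of ?j] by (simp add: mult.left_commute)
    also have "\<dots> = v l * (v ?i * y ?j)" by (rule mult.left_commute)
    finally show ?thesis using l(2) by simp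
  qed
  define \<alpha> where "\<alpha> k = (if k = l then v ((l + 1) mod 3) else if k = (l + 1) mod 3 then - v l else
    0)" for k
  define \<beta> where "\<beta> k = (if k = l then v ((l + 2) mod 3) else if k = (l + 2) mod 3 then - v l else
    0)" for k
  show ?thesis
  proof (rule exI[of _ \<alpha>], rule exI[of _ \<beta>], intro allI impI)
    fix y k assume \<alpha>: "(\<Sum>k<3. \<alpha> k * y k) = 0" and \<beta>: "(\<Sum>k<3. \<beta> k * y k) = 0" and k: "k < (3::nat)"
    have ne: "(l + 1) mod 3 \<noteq> l" "(l + 2) mod 3 \<noteq> l" "(l + 1) mod 3 \<noteq> (l + 2) mod 3"
      using cyclic_3_distinct[OF l(1)] by auto
    show "v ((k + 2) mod 3) * y ((k + 1) mod 3) = v ((k + 1) mod 3) * y ((k + 2) mod 3)"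
    proof (rule goal[OF k, where y = y])
      fix i :: nat assume "i < 3"
      then consider "i = l" | "i = (l + 1) mod 3" | "i = (l + 2) mod 3"
        using cyclic_3_cases[OF l(1)] by blast
      then show "v l * y i = v i * y l"
      proof cases
        case 2
        then show ?thesis using \<alpha> ne not_sym[OF ne(3)] unfolding sum_cyclic_3[OF l(1)] by (simp
          add: \<alpha>_def)
      next
        case 3
        then show ?thesis using \<beta> ne unfolding sum_cyclic_3[OF l(1)] by (simp add: \<beta>_def)
      qed simp
    qed
  qed
qed

text \<open>A summand \<open>v \<otimes> q\<^sup>2\<close> contributes a matrix of rank at most 2 to the flattening: \<open>w\<close> lies in
  its kernel if the contraction of \<open>w\<close> with \<open>q\<close> is parallel to \<open>v\<close>, which is two linear
  conditions. Five summands leave a nonzero \<open>w\<close> in the 12-dimensional space.\<close>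

lemma det_koszul_five_squares:
  fixes v q :: "nat \<Rightarrow> nat \<Rightarrow> complex"
  assumes N: "\<And>k a b. k < 3 \<Longrightarrow> a < 4 \<Longrightarrow> b < 4 \<Longrightarrow> gram N k a b = (\<Sum>j<5. v j k * q j a * q j b)"
  shows "det (koszul N) = 0"
proof -
  obtain \<alpha> \<beta> where par: "\<And>j y k. (\<Sum>k<3. \<alpha> j k * y k) = 0 \<Longrightarrow> (\<Sum>k<3. \<beta> j k * y k) = 0 \<Longrightarrow> k < 3 \<Longrightarrow>
      v j ((k + 2) mod 3) * y ((k + 1) mod 3) = v j ((k + 1) mod 3) * y ((k + 2) mod 3)"
    for y :: "nat \<Rightarrow> complex" and j :: nat
  proof -
    have "\<forall>j::nat. \<exists>\<alpha>. \<exists>\<beta>. \<forall>y. (\<Sum>k<3. \<alpha> k * y k) = 0 \<longrightarrow> (\<Sum>k<3. \<beta> k * y k) = 0 \<longrightarrow>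
      (\<forall>k<3. v j ((k + 2) mod 3) * y ((k + 1) mod 3) = v j ((k + 1) mod 3) * y ((k + 2) mod 3))"
      using parallel_conditions by blast
    from choice[OF this] obtain \<alpha> where "\<forall>j. \<exists>\<beta>. \<forall>y. (\<Sum>k<3. \<alpha> j k * y k) = 0 \<longrightarrow> (\<Sum>k<3. \<beta> k * y k) =
      0 \<longrightarrow>
      (\<forall>k<3. v j ((k + 2) mod 3) * y ((k + 1) mod 3) = v j ((k + 1) mod 3) * y ((k + 2) mod 3))" ..
    from choice[OF this] obtain \<beta> where "\<forall>j. \<forall>y. (\<Sum>k<3. \<alpha> j k * y k) = 0 \<longrightarrow> (\<Sum>k<3. \<beta> j k * y k) = 0 \<longrightarrow>
      (\<forall>k<3. v j ((k + 2) mod 3) * y ((k + 1) mod 3) = v j ((k + 1) mod 3) * y ((k + 2) mod 3))" ..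
    then show ?thesis by (intro that[of \<alpha> \<beta>]) simp
  qed
  \<comment> \<open>Rows 0 to 4 and 5 to 9 hold the ten conditions; rows 10 and 11 are zero, which
    makes the square matrix visibly singular and provides \<open>w\<close>.\<close>
  define l where "l i j = (if i < 5 then \<alpha> i (j div 4) * q i (j mod 4)
    else if i < 10 then \<beta> (i - 5) (j div 4) * q (i - 5) (j mod 4) else 0)" for i j :: nat
  define L where "L = mat 12 12 (\<lambda>(i, j). l i j)"
  have "det L = 0"
    by (rule det_identical_rows[of _ 12 10 11]) (auto simp: L_def l_def)
  moreover have "L \<in> carrier_mat 12 12" by (simp add: L_def)
  ultimately obtain w where w: "w \<in> carrier_vec 12" "w \<noteq> 0\<^sub>v 12" "L *\<^sub>v w = 0\<^sub>v 12"
    using det_0_iff_vec_prod_zero_field[of L 12] by blast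
  have Lw: "(\<Sum>m<3. \<Sum>b<4. l i (4 * m + b) * w $ (4 * m + b)) = 0" if "i < 12" for i
  proof -
    have "(L *\<^sub>v w) $ i = (\<Sum>j<12. l i j * w $ j)"
      using that w(1) by (simp add: L_def scalar_prod_def lessThan_atLeast0)
    then show ?thesis using w(3) that by (simp add: sum_blocks)
  qed
  define y where "y j m = (\<Sum>b<4. q j b * w $ (4 * m + b))" for j m
  have d: "(4 * l + b) div 4 = l" "(4 * l + b) mod 4 = b" if "b < 4" for l b :: nat
    using that by auto
  have \<alpha>: "(\<Sum>m<3. \<alpha> j m * y j m) = 0" if "j < 5" for j
  proof -
    have "(\<Sum>m<3. \<alpha> j m * y j m) = (\<Sum>m<3. \<Sum>b<4. l j (4 * m + b) * w $ (4 * m + b))"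
      unfolding y_def sum_distrib_left using that by (intro sum.cong refl) (simp add: l_def d)
    then show ?thesis using Lw[of j] that by simp
  qed
  have \<beta>: "(\<Sum>m<3. \<beta> j m * y j m) = 0" if "j < 5" for j
  proof -
    have "(\<Sum>m<3. \<beta> j m * y j m) = (\<Sum>m<3. \<Sum>b<4. l (j + 5) (4 * m + b) * w $ (4 * m + b))"
      unfolding y_def sum_distrib_left using that by (intro sum.cong refl) (simp add: l_def d)
    then show ?thesis using Lw[of "j + 5"] that by simp
  qed
  have S: "(\<Sum>b<4. gram N k' a b * w $ (4 * m + b)) = (\<Sum>j<5. v j k' * q j a * y j m)"
    if "k' < 3" "a < 4" for k' a m
  proof -
    have "(\<Sum>b<4. gram N k' a b * w $ (4 * m + b)) = (\<Sum>b<4. \<Sum>j<5. v j k' * q j a * (q j b * w $ (4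
      * m + b)))"
      using that by (intro sum.cong refl) (simp add: N, simp only: sum_distrib_right mult.assoc)
    also have "\<dots> = (\<Sum>j<5. \<Sum>b<4. v j k' * q j a * (q j b * w $ (4 * m + b)))" by (rule sum.swap)
    finally show ?thesis by (simp add: y_def sum_distrib_left)
  qed
  have "koszul N *\<^sub>v w = 0\<^sub>v 12"
  proof (rule eq_vecI)
    fix i assume "i < dim_vec (0\<^sub>v 12 :: complex Matrix.vec)"
    then have "i < 12" by simp
    then obtain k a where ka: "k < 3" "a < 4" "i = 4 * k + a" by (rule lessThan_12_cases)
    have "(koszul N *\<^sub>v w) $ i = (\<Sum>j<5. v j ((k + 2) mod 3) * q j a * y j ((k + 1) mod 3))
        - (\<Sum>j<5. v j ((k + 1) mod 3) * q j a * y j ((k + 2) mod 3))"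
      unfolding ka(3) koszul_mult[OF ka(1,2) w(1)] by (simp add: S ka)
    also have "\<dots> = (\<Sum>j<5. q j a * (v j ((k + 2) mod 3) * y j ((k + 1) mod 3) - v j ((k + 1) mod 3)
      * y j ((k + 2) mod 3)))"
      by (simp add: sum_subtractf algebra_simps)
    also have "\<dots> = 0" using par[OF \<alpha> \<beta> ka(1)] by simp
    finally show "(koszul N *\<^sub>v w) $ i = 0\<^sub>v 12 $ i" using \<open>i < 12\<close> by simp
  qed (simp add: koszul_def)
  then show ?thesis using w unfolding det_koszul_eq_0_iff by blast
qed

section \<open>The determinant on the chart and on \<Sigma>\<close>

definition pivots :: "nat monom list" where
  "pivots = [qm 0 0, qm 1 1, qm 2 2]"

interpretation quad: grass_chart 3 2 3 pivots
  by unfold_locales (auto simp: pivots_def qm_eq_iff qm_in_monoms)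

text \<open>All generators are combinations of the same five squares, and the halving in
  \<open>gram\<close> cancels the factor 2 in the mixed terms of a square.\<close>

lemma det_koszul_Sigma:
  assumes "quad.rowspan N \<in> Sigma_var 3 2 3 5"
  shows "det (koszul N) = 0"
proof -
  obtain Q where Q: "Q \<in> Us 3 2 5" "quad.rowspan N \<subseteq> cpoly.span ((\<lambda>q. q ^ 2) ` Q)"
    using assms by (auto simp: Sigma_var_def)
  have Q': "Q \<subseteq> Sd 3 1" "finite Q" "card Q = 5" using Q(1) by (auto simp: Us_def)
  obtain qs where qs: "set qs = Q" "distinct qs" using finite_distinct_list[OF Q'(2)] by blast
  have len: "length qs = 5" using qs Q'(3) distinct_card by metis
  have "\<forall>k. \<exists>c. k < 3 \<longrightarrow> quad.row_forms N ! k = (\<Sum>j<5. scale_poly (c j) (qs ! j ^ 2))"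
  proof
    fix k
    have "quad.row_forms N ! k \<in> cpoly.span (set (map (\<lambda>q. q ^ 2) qs))" if "k < 3"
      using Q(2) qs(1) that cpoly.span_superset[of "set (quad.row_forms N)"] by (auto simp:
        subset_iff)
    from span_list[OF this] show "\<exists>c. k < 3 \<longrightarrow> quad.row_forms N ! k = (\<Sum>j<5. scale_poly (c j) (qs !
      j ^ 2))"
      by (auto simp: len)
  qed
  from choice[OF this] obtain c
    where "\<forall>k<3. quad.row_forms N ! k = (\<Sum>j<5. scale_poly (c k j) (qs ! j ^ 2))" ..
  then have c: "quad.row_forms N ! k = (\<Sum>j<5. scale_poly (c k j) (qs ! j ^ 2))" if "k < 3" for k
    using that by simp
  define u where "u j a = Poly_Mapping.lookup (qs ! j) (Poly_Mapping.single a 1)" for j a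
  have u: "qs ! j = lin_form 3 (u j)" if "j < 5" for j
  proof -
    have "qs ! j \<in> Sd 3 1" using Q'(1) qs(1) len that nth_mem[of j qs] by auto
    then show ?thesis unfolding u_def by (rule Sd_1_lin_form)
  qed
  show ?thesis
  proof (rule det_koszul_five_squares)
    fix k a b :: nat assume k: "k < 3" and ab: "a < 4" "b < 4"
    have "N (k, qm a b) = Poly_Mapping.lookup (quad.row_forms N ! k) (qm a b)"
      using k ab by (simp add: quad.lookup_row_forms qm_in_monoms)
    also have "\<dots> = (\<Sum>j<5. c k j * ((if a = b then 1 else 2) * u j a * u j b))"
      using ab by (auto simp: c[OF k] lookup_sum lookup_scale_poly u lookup_lin_form_square
        intro!: sum.cong)
    finally show "gram N k a b = (\<Sum>j<5. c k j * u j a * u j b)"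
      by (simp add: gram_def sum_divide_distrib mult.assoc)
  qed
qed

text \<open>Together with the pivots this is the net x0^2 + 2 x1 x2, x1^2 + 2 x0 x3, x2^2 + x3^2.
  Its Gram matrices have entries 0 and 1 with at most one 1 in each row, so every kernel equation
  equates a coordinate with 0 or with another coordinate.\<close>

definition koszul_point :: "nat \<times> nat monom \<Rightarrow> complex" where
  "koszul_point = (\<lambda>_. 0)((0, qm 1 2) := 2, (1, qm 0 3) := 2, (2, qm 3 3) := 1)"

lemma det_koszul_point: "det (koszul (quad.chart koszul_point)) \<noteq> 0"
proof
  let ?N = "quad.chart koszul_point"
  assume "det (koszul ?N) = 0"
  then obtain v where v: "v \<in> carrier_vec 12" "v \<noteq> 0\<^sub>v 12" "koszul ?N *\<^sub>v v = 0\<^sub>v 12"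
    unfolding det_koszul_eq_0_iff by blast
  have eq: "(\<Sum>b<4. gram ?N ((k + 2) mod 3) a b * v $ (4 * ((k + 1) mod 3) + b)) =
    (\<Sum>b<4. gram ?N ((k + 1) mod 3) a b * v $ (4 * ((k + 2) mod 3) + b))" if "k < 3" "a < 4" for k a
    using koszul_mult[OF that v(1), of ?N] v(3) that by simp
  have N: "?N (0, m) = (if m = qm 0 0 then 1 else if m = qm 1 2 then 2 else 0)"
    "?N (1, m) = (if m = qm 1 1 then 1 else if m = qm 0 3 then 2 else 0)"
    "?N (2, m) = (if m = qm 2 2 then 1 else if m = qm 3 3 then 1 else 0)" for m
    unfolding quad.chart_def by (auto simp: pivots_def koszul_point_def qm_eq_iff)
  have g0: "gram ?N 0 a b = (if a = 0 \<and> b = 0 \<or> a = 1 \<and> b = 2 \<or> a = 2 \<and> b = 1 then 1 else 0)" for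
    a b
    unfolding gram_def N qm_eq_iff by auto
  have g1: "gram ?N 1 a b = (if a = 1 \<and> b = 1 \<or> a = 0 \<and> b = 3 \<or> a = 3 \<and> b = 0 then 1 else 0)" for
    a b
    unfolding gram_def N qm_eq_iff by auto
  have g2: "gram ?N 2 a b = (if a = 2 \<and> b = 2 \<or> a = 3 \<and> b = 3 then 1 else 0)" for a b
    unfolding gram_def N qm_eq_iff by auto
  have g2': "gram ?N (Suc (Suc 0)) a b = (if a = 2 \<and> b = 2 \<or> a = 3 \<and> b = 3 then 1 else 0)" for a b
    using g2 unfolding numeral_2_eq_2[symmetric] .
  have g1': "gram ?N (Suc 0) a b = (if a = 1 \<and> b = 1 \<or> a = 0 \<and> b = 3 \<or> a = 3 \<and> b = 0 then 1 else
    0)" for a b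
    using g1 unfolding One_nat_def[symmetric] .
  note g = g0 g1 g1' g2 g2'
  have s4: "(\<Sum>b<4. F b) = F 0 + F 1 + F 2 + F 3" for F :: "nat \<Rightarrow> complex"
  proof -
    have "{..<4::nat} = {0, 1, 2, 3}" by auto
    then show ?thesis by simp
  qed
  have e0: "v $ 11 = 0" using eq[of 0 0] by (simp add: s4 g del: One_nat_def)
  have e1: "v $ 9 = 0" using eq[of 0 1] by (simp add: s4 g del: One_nat_def)
  have e2: "v $ 6 = 0" using eq[of 0 2] by (simp add: s4 g del: One_nat_def)
  have e3: "v $ 7 = v $ 8" using eq[of 0 3] by (simp add: s4 g del: One_nat_def)
  have e4: "v $ 8 = 0" using eq[of 1 0] by (simp add: s4 g del: One_nat_def)
  have e5: "v $ 10 = 0" using eq[of 1 1] by (simp add: s4 g del: One_nat_def)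
  have e6: "v $ 9 = v $ 2" using eq[of 1 2] by (simp add: s4 g del: One_nat_def)
  have e7: "v $ 3 = 0" using eq[of 1 3] by (simp add: s4 g del: One_nat_def)
  have e8: "v $ 3 = v $ 4" using eq[of 2 0] by (simp add: s4 g del: One_nat_def)
  have e9: "v $ 1 = v $ 6" using eq[of 2 1] by (simp add: s4 g del: One_nat_def)
  have e10: "v $ 5 = 0" using eq[of 2 2] by (simp add: s4 g del: One_nat_def)
  have e11: "v $ 0 = 0" using eq[of 2 3] by (simp add: s4 g del: One_nat_def)
  have "v $ i = 0" if "i < 12" for i
  proof -
    have "i \<in> {0, 1, 2, 3, 4, 5, 6, 7, 8, 9, 10, 11}" using that unfolding insert_iff empty_iff by
      arith
    then show ?thesis
      using e0 e1 e2 e3 e4 e5 e6 e7 e8 e9 e10 e11 by (elim insertE) simp_all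
  qed
  then have "v = 0\<^sub>v 12" using v(1) by (intro eq_vecI) auto
  then show False using v(2) by simp
qed

lemma polyfuns_if:
  "f \<in> polyfuns I \<Longrightarrow> g \<in> polyfuns I \<Longrightarrow> (\<lambda>x. if P then f x else g x) \<in> polyfuns I"
  by (cases P) simp_all

lemma polyfuns_det_koszul: "(\<lambda>x. det (koszul (quad.chart x))) \<in> polyfuns quad.free_entries"
proof -
  have s: "(\<lambda>x. gram (quad.chart x) k a b) \<in> polyfuns quad.free_entries" if "k < 3" "a < 4" "b <
    4" for k a b
  proof -
    have "(k, qm a b) \<in> quad.entries" using that by (simp add: quad.entries_def qm_in_monoms)
    from polyfuns.mult[OF quad.polyfuns_chart[OF this] polyfuns.const[of "1 / (if a = b then 1
      else 2)"]]
    show ?thesis by (simp add: gram_def)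
  qed
  show ?thesis unfolding koszul_def
  proof (rule polyfuns_det)
    fix i j :: nat assume "i < 12" "j < 12"
    then show "(\<lambda>x. koszul_entry (quad.chart x) i j) \<in> polyfuns quad.free_entries"
      unfolding koszul_entry_def by (intro polyfuns_if s polyfuns_uminus polyfuns.const) auto
  qed
qed

lemma closure_Sigma_ne_Grass:
  "zariski_Grass 3 2 3 closure_of Sigma_var 3 2 3 5 \<noteq> Grass 3 2 3"
proof
  assume eq: "zariski_Grass 3 2 3 closure_of Sigma_var 3 2 3 5 = Grass 3 2 3"
  let ?U = "{quad.rowspan (quad.chart x) | x. det (koszul (quad.chart x)) \<noteq> 0}"
  have "openin (zariski_Grass 3 2 3) ?U" by (rule quad.openin_chart[OF polyfuns_det_koszul])
  moreover have "quad.rowspan (quad.chart koszul_point) \<in> ?U" using det_koszul_point by blast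
  moreover have "\<forall>T. quad.rowspan (quad.chart koszul_point) \<in> T \<and> openin (zariski_Grass 3 2 3) T
      \<longrightarrow> (\<exists>L. L \<in> Sigma_var 3 2 3 5 \<and> L \<in> T)"
    using quad.rowspan_in_Grass[OF quad.full_rank_chart, of koszul_point]
    unfolding eq[symmetric] in_closure_of by (rule conjunct2)
  ultimately have "\<exists>L. L \<in> Sigma_var 3 2 3 5 \<and> L \<in> ?U" by (elim allE[of _ ?U]) simp
  then obtain x where "quad.rowspan (quad.chart x) \<in> Sigma_var 3 2 3 5" "det (koszul (quad.chart
    x)) \<noteq> 0"
    by (elim exE conjE CollectE) simp
  then show False using det_koszul_Sigma[of "quad.chart x"] by simp
qed

section \<open>Nets spanned by five squares\<close>

text \<open>Parameters \<open>(True, j, a)\<close> are the coefficients of the linear forms \<open>q\<^sub>j\<close>, and \<open>(False, j, k)\<close>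
  are the coefficients with which their squares enter the \<open>k\<close>-th generator of the net.\<close>

definition net :: "(bool \<times> nat \<times> nat \<Rightarrow> complex) \<Rightarrow> nat \<times> nat monom \<Rightarrow> complex" where
  "net p = (\<lambda>(k, m). \<Sum>j<5. p (False, j, k) *
     Poly_Mapping.lookup (lin_form 3 (\<lambda>a. p (True, j, a)) ^ 2) m)"

definition squares :: "(bool \<times> nat \<times> nat \<Rightarrow> complex) \<Rightarrow> nat cpoly list" where
  "squares p = map (\<lambda>j. lin_form 3 (\<lambda>a. p (True, j, a)) ^ 2) [0..<5]"

text \<open>At \<open>base\<close> the first four squares are x_j^2, and x0 x1 occurs only in the
  fifth, so the coefficient matrix for these monomials is lower triangular.\<close>

definition square_monoms :: "nat monom list" where
  "square_monoms = [qm 0 0, qm 1 1, qm 2 2, qm 3 3, qm 0 1]"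

text \<open>Two open conditions in one polynomial: the first minor makes the five squares
  independent, so that they come from a point of \<open>Us\<close>; the second gives the net full
  rank and places it in the chart.\<close>

definition nondegenerate :: "(bool \<times> nat \<times> nat \<Rightarrow> complex) \<Rightarrow> complex" where
  "nondegenerate p = pluecker (squares p) square_monoms * pluecker (quad.row_forms (net p)) pivots"

lemma net_qm:
  assumes "a \<le> 3" "b \<le> 3"
  shows "net p (k, qm a b) =
    (if a = b then 1 else 2) * (\<Sum>j<5. p (False, j, k) * p (True, j, a) * p (True, j, b))"
proof -
  have "net p (k, qm a b) =
      (\<Sum>j<5. p (False, j, k) * ((if a = b then 1 else 2) * p (True, j, a) * p (True, j, b)))"
    using lookup_lin_form_square[OF assms] by (simp add: net_def)
  also have "\<dots> = (if a = b then 1 else 2) * (\<Sum>j<5. p (False, j, k) * p (True, j, a) * p (True, j,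
    b))"
    by (simp add: sum_distrib_left mult_ac)
  finally show ?thesis .
qed

lemma entries_cases:
  assumes "i \<in> quad.entries"
  obtains k a b where "k < 3" "a \<le> b" "b \<le> 3" "i = (k, qm a b)"
  using assms unfolding quad.entries_def monoms_2 by auto

lemma polyfuns_net:
  assumes "i \<in> quad.entries"
  shows "(\<lambda>p. net p i) \<in> polyfuns UNIV"
proof -
  obtain k a b where i: "a \<le> b" "b \<le> 3" "i = (k, qm a b)" using assms by (rule entries_cases)
  then have "net p i = (if a = b then 1 else 2) * (\<Sum>j<5. p (False, j, k) * p (True, j, a) * p
    (True, j, b))" for p
    by (simp only: i(3), intro net_qm) auto
  moreover have "(\<lambda>p. (if a = b then 1 else 2) * (\<Sum>j<5. p (False, j, k) * p (True, j, a) * p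
    (True, j, b))) \<in> polyfuns UNIV"
    by (intro polyfuns.mult polyfuns.const polyfuns_sum polyfuns.var UNIV_I)
  ultimately show ?thesis by simp
qed

lemma lookup_squares:
  assumes "i < 5" "j < 5"
  shows "\<exists>a b. \<forall>p. Poly_Mapping.lookup (squares p ! i) (square_monoms ! j)
      = (if a = b then 1 else 2) * p (True, i, a) * p (True, i, b)"
proof -
  have "set square_monoms \<subseteq> monoms {..3} 2"
    by (simp add: square_monoms_def qm_in_monoms)
  moreover have "square_monoms ! j \<in> set square_monoms"
    using assms(2) by (intro nth_mem) (simp add: square_monoms_def)
  ultimately obtain a b where ab: "square_monoms ! j = qm a b" "a \<le> b" "b \<le> 3"
    unfolding monoms_2 by auto
  then have "a \<le> 3" by simp
  then show ?thesis
    using ab assms(1) by (intro exI[of _ a] exI[of _ b]) (simp add: squares_def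
      lookup_lin_form_square)
qed

lemma polyfuns_nondegenerate: "nondegenerate \<in> polyfuns UNIV"
proof -
  have "(\<lambda>p. pluecker (quad.row_forms (net p)) pivots) \<in> polyfuns UNIV"
    by (rule polyfuns_comp[OF quad.polyfuns_pluecker_row_forms[OF quad.pv_in_index] polyfuns_net])
  moreover have "(\<lambda>p. pluecker (squares p) square_monoms) \<in> polyfuns UNIV"
  proof -
    have l: "length (squares p) = 5" for p by (simp add: squares_def)
    have "(\<lambda>p. Poly_Mapping.lookup (squares p ! i) (square_monoms ! j)) \<in> polyfuns UNIV"
      if ij: "i < 5" "j < 5" for i j
    proof -
      obtain a b where "\<forall>p. Poly_Mapping.lookup (squares p ! i) (square_monoms ! j)
          = (if a = b then 1 else 2) * p (True, i, a) * p (True, i, b)"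
        using lookup_squares[OF ij] by (elim exE)
      then show ?thesis
        by (simp only:) (intro polyfuns.mult polyfuns.const polyfuns.var UNIV_I)
    qed
    then show ?thesis unfolding pluecker_def l by (rule polyfuns_det)
  qed
  ultimately have "(\<lambda>p. nondegenerate p) \<in> polyfuns UNIV"
    unfolding nondegenerate_def by (intro polyfuns.mult)
  then show ?thesis by simp
qed

lemma net_full_rank: "nondegenerate p \<noteq> 0 \<Longrightarrow> quad.full_rank (net p)"
  by (rule quad.full_rank_if_pluecker[of "net p" pivots]) (simp add: nondegenerate_def)

lemma net_in_Sigma:
  assumes "nondegenerate p \<noteq> 0"
  shows "quad.rowspan (net p) \<in> Sigma_var 3 2 3 5"
proof -
  define qs where "qs = map (\<lambda>j. lin_form 3 (\<lambda>a. p (True, j, a))) [0..<5]"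
  have sq: "squares p = map (\<lambda>q. q ^ 2) qs" by (simp add: qs_def squares_def)
  have "distinct (squares p) \<and> cpoly.independent (set (squares p))"
    using assms by (intro pluecker_nonzero_imp_independent[of _ square_monoms]) (simp add:
      nondegenerate_def)
  then have d: "distinct qs" "inj_on (\<lambda>q. q ^ 2) (set qs)" "cpoly.independent ((\<lambda>q. q ^ 2) ` set
    qs)"
    by (simp_all add: sq distinct_map)
  have "card (set qs) = 5" using distinct_card[OF d(1)] by (simp add: qs_def)
  moreover have "set qs \<subseteq> Sd 3 1" using lin_form_in_Sd by (auto simp: qs_def)
  ultimately have Q: "set qs \<in> Us 3 2 5" using d by (simp add: Us_def)
  have "set (quad.row_forms (net p)) \<subseteq> cpoly.span (set (squares p))"
  proof
    fix x assume "x \<in> set (quad.row_forms (net p))"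
    then obtain k where k: "k < 3" "x = quad.row_forms (net p) ! k" by (auto simp: in_set_conv_nth)
    have S: "squares p ! j \<in> Sd 3 2" if "j < 5" for j
      using that forms_power[of "lin_form 3 (\<lambda>a. p (True, j, a))" "{..3}" 1 2] lin_form_in_Sd[of 3]
      by (simp add: squares_def Sd_def)
    have "x = (\<Sum>j<5. scale_poly (p (False, j, k)) (squares p ! j))"
    proof (rule poly_mapping_eqI)
      fix m
      show "Poly_Mapping.lookup x m = Poly_Mapping.lookup (\<Sum>j<5. scale_poly (p (False, j, k))
        (squares p ! j)) m"
      proof (cases "m \<in> monoms {..3} 2")
        case True
        then show ?thesis
          by (simp add: k quad.lookup_row_forms net_def lookup_sum lookup_scale_poly squares_def)
      next
        case False
        then have "Poly_Mapping.lookup (squares p ! j) m = 0" if "j < 5" for j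
          using S[OF that] by (auto simp: Sd_def forms_def in_keys_iff)
        then show ?thesis using False by (simp add: k quad.lookup_row_forms lookup_sum
          lookup_scale_poly)
      qed
    qed
    then show "x \<in> cpoly.span (set (squares p))"
      by (auto simp: squares_def intro!: cpoly.span_sum cpoly.span_scale intro: cpoly.span_base)
  qed
  then have "quad.rowspan (net p) \<subseteq> cpoly.span ((\<lambda>q. q ^ 2) ` set qs)"
    using cpoly.span_minimal[OF _ cpoly.subspace_span] by (simp add: sq)
  then show ?thesis
    using Q quad.rowspan_in_Grass[OF net_full_rank[OF assms]] by (auto simp: Sigma_var_def)
qed

subsection \<open>A point where the parametrization has rank 20\<close>

text \<open>The base point has \<open>q\<^sub>0, \<dots>, q\<^sub>3\<close> the coordinates and \<open>q\<^sub>4\<close> their sum; the coefficients of the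
  squares are chosen such that the pivot columns of the net form the identity matrix.\<close>

definition base_coeff :: "nat \<Rightarrow> nat \<Rightarrow> complex" where
  "base_coeff j k = [[1, -1, -1], [0, 0, -1], [0, -1, 0], [-1, 0, 0], [0, 1, 1]] ! j ! k"

definition base :: "bool \<times> nat \<times> nat \<Rightarrow> complex" where
  "base = (\<lambda>(s, j, i). if s then (if j = i \<or> j = 4 then 1 else 0) else base_coeff j i)"

text \<open>A right inverse of the derivative of \<open>net\<close> at \<open>base\<close>, for targets \<open>z\<close> outside the entry
  \<open>(0, x\<^sub>0 x\<^sub>1)\<close>. The corrections of \<open>q\<^sub>4\<close> and of its coefficients make the residue in the column of
  each \<open>x\<^sub>a x\<^sub>b\<close> a combination of the coefficients of \<open>q\<^sub>a\<^sup>2\<close> and \<open>q\<^sub>b\<^sup>2\<close>; then the corrections of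
  \<open>q\<^sub>a\<close> and \<open>q\<^sub>b\<close> absorb it.\<close>

definition corr_coeff4 :: "(nat \<times> nat monom \<Rightarrow> complex) \<Rightarrow> nat \<Rightarrow> complex" where
  "corr_coeff4 z k = [z (0, qm 1 2) / 2, (z (1, qm 0 3) - z (2, qm 0 3)) / 2, 0] ! k"

definition corr_form4 :: "(nat \<times> nat monom \<Rightarrow> complex) \<Rightarrow> nat \<Rightarrow> complex" where
  "corr_form4 z a = [(z (0, qm 0 2) + z (2, qm 0 2) - z (0, qm 1 2) - z (2, qm 2 3)) / 2,
     (z (2, qm 0 3) - z (1, qm 0 3) + z (1, qm 1 3)) / 2, z (2, qm 2 3) / 2, 0] ! a"

definition residue :: "(nat \<times> nat monom \<Rightarrow> complex) \<Rightarrow> nat \<Rightarrow> nat \<Rightarrow> nat \<Rightarrow> complex" where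
  "residue z a b k = z (k, qm a b) / 2 - corr_coeff4 z k - base_coeff 4 k * (corr_form4 z a +
    corr_form4 z b)"

definition corr_form :: "(nat \<times> nat monom \<Rightarrow> complex) \<Rightarrow> nat \<Rightarrow> nat \<Rightarrow> complex" where
  "corr_form z j a =
    [[0, - residue z 0 1 1, residue z 0 2 0, - residue z 0 3 1],
     [residue z 0 1 1 - residue z 0 1 2, 0, - residue z 1 2 2, - residue z 1 3 2],
     [- residue z 0 2 1 - residue z 0 2 0, - residue z 1 2 1, 0, - residue z 2 3 1],
     [- residue z 0 3 1 - residue z 0 3 0, - residue z 1 3 0, - residue z 2 3 0, 0],
     [corr_form4 z 0, corr_form4 z 1, corr_form4 z 2, corr_form4 z 3]] ! j ! a"

definition corr_coeff :: "(nat \<times> nat monom \<Rightarrow> complex) \<Rightarrow> nat \<Rightarrow> nat \<Rightarrow> complex" where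
  "corr_coeff z j k = (if j = 4 then corr_coeff4 z k
     else z (k, qm j j) - corr_coeff4 z k - 2 * base_coeff 4 k * corr_form4 z j)"

lemma sum_lessThan_5: "(\<Sum>j<5. F j) = F 0 + F 1 + F 2 + F 3 + (F 4 :: complex)" for F :: "nat \<Rightarrow>
  complex"
proof -
  have "{..<5::nat} = {0, 1, 2, 3, 4}" by auto
  then show ?thesis by simp
qed

lemma quad_entry_cases:
  assumes "k < (3::nat)" "a \<le> b" "b \<le> (3::nat)"
  shows "k \<in> {0, 1, 2} \<and> (a, b) \<in> {(0,0), (0,1), (0,2), (0,3), (1,1), (1,2), (1,3), (2,2), (2,3),
    (3,3)}"
  using assms unfolding insert_iff empty_iff prod.inject by arith

text \<open>On the diagonal, \<open>corr_coeff\<close> absorbs everything. For a pair a < b, the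
  corrections of q_a and q_b have to solve three equations in two unknowns, so each pair imposes one
  linear condition on its residue. The pairs (1,2), (0,3), (1,3), (2,3), (0,2), in this order,
  determine the five entries of \<open>corr_coeff4\<close> and \<open>corr_form4\<close> that are
  not set to 0. Nothing is left to meet the condition of the pair (0,1), which is why one of its
  three entries is excluded.\<close>

lemma net_derivative:
  assumes "k < 3" "a \<le> b" "b \<le> 3" "(k, a, b) \<noteq> (0, 0, 1)"
  shows "(if a = b then 1 else 2) * (\<Sum>j<5. corr_coeff z j k * base (True, j, a) * base (True, j, b)
     + base_coeff j k * (corr_form z j a * base (True, j, b) + base (True, j, a) * corr_form z j b))
    = z (k, qm a b)"
  using quad_entry_cases[OF assms(1-3)] assms(4)
  unfolding sum_lessThan_5
  by (elim conjE insertE emptyE)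
     (simp_all add: base_def corr_coeff_def corr_form_def residue_def corr_coeff4_def corr_form4_def
       base_coeff_def field_simps)

definition correction :: "(nat \<times> nat monom \<Rightarrow> complex) \<Rightarrow> bool \<times> nat \<times> nat \<Rightarrow> complex" where
  "correction z = (\<lambda>(s, j, i). if s \<and> j < 5 \<and> i < 4 then corr_form z j i
     else if \<not> s \<and> j < 5 \<and> i < 3 then corr_coeff z j i else 0)"

lemma less_4_cases: "a < (4::nat) \<longleftrightarrow> a = 0 \<or> a = 1 \<or> a = 2 \<or> a = 3"
  by arith

lemma less_5_cases: "a < (5::nat) \<longleftrightarrow> a = 0 \<or> a = 1 \<or> a = 2 \<or> a = 3 \<or> a = 4"
  by arith

lemma correction_linear:
  "correction (\<lambda>e. c * x e + y e) i = c * correction x i + correction y i"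
proof -
  have c: "corr_coeff4 (\<lambda>e. c * x e + y e) k = c * corr_coeff4 x k + corr_coeff4 y k" if "k < 3"
    for k
    using that unfolding less_3_cases
    by (elim disjE) (simp_all add: corr_coeff4_def field_simps)
  have f: "corr_form4 (\<lambda>e. c * x e + y e) a = c * corr_form4 x a + corr_form4 y a" if "a < 4" for a
    using that unfolding less_4_cases
    by (elim disjE) (simp_all add: corr_form4_def field_simps)
  have r: "residue (\<lambda>e. c * x e + y e) a b k = c * residue x a b k + residue y a b k"
    if "k < 3" "a < 4" "b < 4" for a b k
    unfolding residue_def c[OF that(1)] f[OF that(2)] f[OF that(3)] by (simp add: field_simps)
  have F: "corr_form (\<lambda>e. c * x e + y e) j a = c * corr_form x j a + corr_form y j a" if "j < 5"
    "a < 4" for j a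
    using that unfolding less_5_cases less_4_cases
    by (elim disjE) (simp_all add: corr_form_def r f, simp_all add: algebra_simps)
  have C: "corr_coeff (\<lambda>e. c * x e + y e) j k = c * corr_coeff x j k + corr_coeff y j k" if "j <
    5" "k < 3" for j k
    using that by (cases "j = 4") (simp_all add: corr_coeff_def c f, simp_all add: algebra_simps)
  show ?thesis by (cases i) (simp add: correction_def F C)
qed

lemma square_monoms_nth: "j < 5 \<Longrightarrow> square_monoms ! j = (if j = 4 then qm 0 1 else qm j j)"
  unfolding less_5_cases by (elim disjE) (simp_all add: square_monoms_def)

lemma pivots_nth: "j < 3 \<Longrightarrow> pivots ! j = qm j j"
  unfolding less_3_cases by (elim disjE) (simp_all add: pivots_def)

lemma net_base_pivot: "k < 3 \<Longrightarrow> j < 3 \<Longrightarrow> net base (k, qm j j) = (if k = j then 1 else 0)"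
  unfolding less_3_cases
  by (elim disjE) (simp_all add: net_qm sum_lessThan_5 base_def base_coeff_def)

lemma nondegenerate_base: "nondegenerate base \<noteq> 0"
proof -
  let ?A = "mat 5 5 (\<lambda>(i, j). Poly_Mapping.lookup (squares base ! i) (square_monoms ! j))"
  have A: "?A $$ (i, j) = (if j = 4 then 2 * base (True, i, 0) * base (True, i, 1) else base
    (True, i, j) * base (True, i, j))"
    if "i < 5" "j < 5" for i j
    using that by (simp add: square_monoms_nth squares_def lookup_lin_form_square)
  have "det ?A = prod_list (diag_mat ?A)"
  proof (rule det_lower_triangular[of 5])
    fix i j :: nat assume "i < j" "j < 5"
    then show "?A $$ (i, j) = 0" by (subst A) (auto simp: base_def)
  qed simp
  moreover have "0 \<notin> set (diag_mat ?A)"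
  proof
    assume "0 \<in> set (diag_mat ?A)"
    then obtain i where "i < 5" "?A $$ (i, i) = 0" by (auto simp: diag_mat_def)
    then show False by (simp only: A) (auto simp: base_def split: if_splits)
  qed
  ultimately have "pluecker (squares base) square_monoms \<noteq> 0"
    by (simp add: pluecker_def squares_def prod_list_zero_iff)
  moreover have "pluecker (quad.row_forms (net base)) pivots = 1"
  proof -
    have "mat 3 3 (\<lambda>(i, j). net base (i, pivots ! j)) = 1\<^sub>m 3"
      by (intro eq_matI) (simp_all add: pivots_nth net_base_pivot)
    then show ?thesis by (simp add: quad.pluecker_row_forms[OF quad.length_pv quad.pv_monoms])
  qed
  ultimately show ?thesis by (simp add: nondegenerate_def)
qed

subsection \<open>The parametrization is open at the base point\<close>

lemma continuous_on_polyfuns: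
  assumes "f \<in> polyfuns I" "\<And>i. i \<in> I \<Longrightarrow> continuous_on S (\<lambda>z. P z i)"
  shows "continuous_on S (\<lambda>z. f (P z))"
  using assms by (induction rule: polyfuns.induct) (auto intro: continuous_intros)

lemma continuous_on_vecI:
  "(\<And>i. continuous_on S (\<lambda>x. f x i)) \<Longrightarrow> continuous_on S (\<lambda>x. vec_lambda (f x))"
  unfolding continuous_on_def by (auto intro: tendsto_vec_lambda)

lemma has_derivative_vecI:
  fixes f :: "'a::real_normed_vector \<Rightarrow> (complex, 'n::finite) Finite_Cartesian_Product.vec"
  assumes "\<And>i. ((\<lambda>x. vec_nth (f x) i) has_derivative (\<lambda>h. vec_nth (f' h) i)) (at x)"
  shows "(f has_derivative f') (at x)"
  unfolding has_derivative_componentwise_within[of f]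
  by (auto simp: Basis_vec_def inner_axis intro!: has_derivative_inner_left assms)

text \<open>A finite index type, so that the coefficient matrices form a Euclidean space to which an
  open mapping theorem applies.\<close>

typedef entry = quad.entries
  by (rule exI[of _ "(0, qm 0 0)"]) (simp add: quad.entries_def qm_in_monoms)

instance entry :: finite
proof
  have "finite quad.entries" by (simp add: quad.entries_def finite_monoms)
  then have "finite (Abs_entry ` quad.entries)" by simp
  then show "finite (UNIV :: entry set)"
    using type_definition.Abs_image[OF type_definition_entry] by simp
qed

text \<open>Moving from \<open>base\<close> along \<open>correction\<close>, a right inverse of the
  derivative, gives a map \<open>F\<close> whose derivative at 0 is the identity; hence its image
  contains a ball.\<close>

lemma net_locally_surjective:
  "\<exists>\<epsilon>>0. \<forall>y. (\<forall>e\<in>quad.entries. norm (y e - net base e) < \<epsilon>) \<longrightarrow>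
     (\<exists>p. nondegenerate p \<noteq> 0 \<and> (\<forall>e\<in>quad.entries - {(0, qm 0 1)}. net p e = y e))"
proof -
  define D :: "(complex, entry) Finite_Cartesian_Product.vec \<Rightarrow> bool \<times> nat \<times> nat \<Rightarrow> complex" where
    "D z = correction (\<lambda>e. vec_nth z (Abs_entry e))" for z
  define P where "P z i = base i + D z i" for z i
  \<comment> \<open>The excluded entry is filled with its own coordinate, so that the derivative is
    the identity on the whole space and not only on the other entries.\<close>
  define F :: "(complex, entry) Finite_Cartesian_Product.vec \<Rightarrow> (complex, entry)
    Finite_Cartesian_Product.vec" where
    "F z = vec_lambda (\<lambda>e. if Rep_entry e = (0, qm 0 1) then net base (0, qm 0 1) + vec_nth z e
       else net (P z) (Rep_entry e))" for z
  define S where "S = {z. nondegenerate (P z) \<noteq> 0}"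
  have Dadd: "D (x + y) i = D x i + D y i" for x y i
    using correction_linear[of 1 "\<lambda>e. vec_nth x (Abs_entry e)" "\<lambda>e. vec_nth y (Abs_entry e)" i]
    by (simp add: D_def)
  have D0: "D 0 i = 0" for i using Dadd[of 0 0 i] by simp
  have c0: "correction (\<lambda>_. 0) i = 0" for i
    using correction_linear[of 1 "\<lambda>_. 0" "\<lambda>_. 0" i] by simp
  have Dscale: "D (r *\<^sub>R x) i = r *\<^sub>R D x i" for r x i
  proof -
    have "(\<lambda>e. vec_nth (r *\<^sub>R x) (Abs_entry e)) = (\<lambda>e. of_real r * vec_nth x (Abs_entry e) + 0)"
      by (simp add: scaleR_conv_of_real[where 'a = complex])
    then show ?thesis
      unfolding D_def by (simp only: correction_linear c0) (simp add: scaleR_conv_of_real)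
  qed
  have bD: "bounded_linear (\<lambda>z. D z i)" for i
    unfolding linear_conv_bounded_linear[symmetric] by (rule linearI) (simp_all add: Dadd Dscale)
  have dP: "((\<lambda>z. P z i) has_derivative (\<lambda>h. D h i)) (at z)" for i z
    unfolding P_def using bounded_linear_imp_has_derivative[OF bD, of i "at z"]
    by (auto intro!: derivative_eq_intros)
  have P0: "P 0 = base" by (rule ext) (simp add: P_def D0)
  have contP: "continuous_on UNIV (\<lambda>z. P z i)" for i
    by (rule has_derivative_continuous_on[where f' = "\<lambda>_ h. D h i"]) (rule dP)
  have "open S"
  proof -
    have "continuous_on UNIV (\<lambda>z. nondegenerate (P z))"
      by (rule continuous_on_polyfuns[OF polyfuns_nondegenerate contP])
    then show ?thesis unfolding S_def by (intro open_Collect_neq continuous_on_const)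
  qed
  moreover have "continuous_on S F"
    unfolding F_def
  proof (rule continuous_on_vecI)
    fix e
    have "continuous_on UNIV (\<lambda>z. net (P z) (Rep_entry e))"
      by (rule continuous_on_polyfuns[OF polyfuns_net[OF Rep_entry] contP])
    then have "continuous_on S (\<lambda>z. net (P z) (Rep_entry e))" by (rule continuous_on_subset) simp
    then show "continuous_on S (\<lambda>z. if Rep_entry e = (0, qm 0 1) then net base (0, qm 0 1) +
      vec_nth z e
       else net (P z) (Rep_entry e))"
      using continuous_on_add[OF continuous_on_const linear_continuous_on[OF
        bounded_linear_vec_nth]]
      by (cases "Rep_entry e = (0, qm 0 1)") simp_all
  qed
  moreover have "0 \<in> S" using nondegenerate_base by (simp add: S_def P0)
  moreover have "(F has_derivative id) (at 0)"
  proof (rule has_derivative_vecI)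
    fix e
    show "((\<lambda>z. vec_nth (F z) e) has_derivative (\<lambda>h. vec_nth (id h) e)) (at 0)"
    proof (cases "Rep_entry e = (0, qm 0 1)")
      case True
      then show ?thesis
        using bounded_linear_imp_has_derivative[OF bounded_linear_vec_nth, of e "at 0"]
        by (auto simp: F_def intro!: derivative_eq_intros)
    next
      case False
      obtain k a b where e: "k < 3" "a \<le> b" "b \<le> 3" "Rep_entry e = (k, qm a b)"
        using entries_cases[OF Rep_entry] .
      have ne: "(k, a, b) \<noteq> (0, 0, 1)" using False e(4) by auto
      let ?c = "if a = b then 1 else 2 :: complex"
      have "((\<lambda>z. ?c * (\<Sum>j<5. P z (False, j, k) * P z (True, j, a) * P z (True, j, b)))
        has_derivative
        (\<lambda>h. ?c * (\<Sum>j<5. D h (False, j, k) * base (True, j, a) * base (True, j, b)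
          + base (False, j, k) * (D h (True, j, a) * base (True, j, b) + base (True, j, a) * D h
            (True, j, b))))) (at 0)"
      proof (intro has_derivative_mult_right has_derivative_sum)
        fix j
        show "((\<lambda>z. P z (False, j, k) * P z (True, j, a) * P z (True, j, b)) has_derivative
          (\<lambda>h. D h (False, j, k) * base (True, j, a) * base (True, j, b)
          + base (False, j, k) * (D h (True, j, a) * base (True, j, b) + base (True, j, a) * D h
            (True, j, b)))) (at 0)"
          by (rule has_derivative_eq_rhs[OF has_derivative_mult[OF has_derivative_mult[OF dP dP]
            dP]])
             (simp add: P0 fun_eq_iff algebra_simps)
      qed
      moreover have "(\<lambda>z. ?c * (\<Sum>j<5. P z (False, j, k) * P z (True, j, a) * P z (True, j, b)))
          = (\<lambda>z. vec_nth (F z) e)"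
      proof
        fix z
        have "vec_nth (F z) e = net (P z) (k, qm a b)"
          unfolding F_def e(4)[symmetric] using False by simp
        then show "?c * (\<Sum>j<5. P z (False, j, k) * P z (True, j, a) * P z (True, j, b)) = vec_nth
          (F z) e"
          using e(2,3) by (simp add: net_qm)
      qed
      moreover have "(\<lambda>h. ?c * (\<Sum>j<5. D h (False, j, k) * base (True, j, a) * base (True, j, b)
          + base (False, j, k) * (D h (True, j, a) * base (True, j, b) + base (True, j, a) * D h
            (True, j, b))))
          = (\<lambda>h. vec_nth (id h) e)"
      proof
        fix h
        have "(\<Sum>j<5. D h (False, j, k) * base (True, j, a) * base (True, j, b)
          + base (False, j, k) * (D h (True, j, a) * base (True, j, b) + base (True, j, a) * D h
            (True, j, b)))
          = (\<Sum>j<5. corr_coeff (\<lambda>e. vec_nth h (Abs_entry e)) j k * base (True, j, a) * base (True,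
            j, b)
          + base_coeff j k * (corr_form (\<lambda>e. vec_nth h (Abs_entry e)) j a * base (True, j, b)
            + base (True, j, a) * corr_form (\<lambda>e. vec_nth h (Abs_entry e)) j b))"
          using e by (intro sum.cong refl) (simp add: D_def correction_def base_def)
        then show "?c * (\<Sum>j<5. D h (False, j, k) * base (True, j, a) * base (True, j, b)
          + base (False, j, k) * (D h (True, j, a) * base (True, j, b) + base (True, j, a) * D h
            (True, j, b)))
          = vec_nth (id h) e"
          using net_derivative[OF e(1-3) ne, of "\<lambda>e. vec_nth h (Abs_entry e)"]
          by (simp add: e(4)[symmetric] Rep_entry_inverse)
      qed
      ultimately show ?thesis by simp
    qed
  qed
  ultimately have "F 0 \<in> interior (F ` S)"
    by (intro sussmann_open_mapping[where f' = id and g' = id and S = S])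
       (auto simp: interior_open intro: bounded_linear_ident[folded id_def])
  then obtain \<epsilon> where \<epsilon>: "\<epsilon> > 0" "ball (F 0) \<epsilon> \<subseteq> F ` S"
    unfolding mem_interior by blast
  \<comment> \<open>The norm is at most the sum of the norms of the coordinates, so each coordinate
    gets an equal share of \<epsilon>.\<close>
  define \<delta> where "\<delta> = \<epsilon> / of_nat (card (UNIV :: entry set))"
  have cpos: "card (UNIV :: entry set) > 0" by (simp add: card_gt_0_iff)
  have "\<exists>p. nondegenerate p \<noteq> 0 \<and> (\<forall>e\<in>quad.entries - {(0, qm 0 1)}. net p e = y e)"
    if y: "\<forall>e\<in>quad.entries. norm (y e - net base e) < \<delta>" for y
  proof -
    define v :: "(complex, entry) Finite_Cartesian_Product.vec" where "v = vec_lambda (\<lambda>e. y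
      (Rep_entry e))"
    have F0: "vec_nth (F 0) e = net base (Rep_entry e)" for e by (simp add: F_def P0)
    have "norm (v - F 0) \<le> (\<Sum>e\<in>UNIV. norm (vec_nth (v - F 0) e))"
      unfolding norm_vec_def by (rule L2_set_le_sum) simp
    also have "\<dots> < (\<Sum>e\<in>(UNIV :: entry set). \<delta>)"
      by (rule sum_strict_mono) (use y Rep_entry in \<open>auto simp: v_def F0\<close>)
    also have "\<dots> = \<epsilon>" using cpos by (simp add: \<delta>_def)
    finally have "v \<in> ball (F 0) \<epsilon>" by (simp add: dist_norm norm_minus_commute)
    then obtain z where z: "z \<in> S" "v = F z" using \<epsilon>(2) by blast
    have "net (P z) e = y e" if "e \<in> quad.entries - {(0, qm 0 1)}" for e
    proof -
      have R: "Rep_entry (Abs_entry e) = e" using that by (simp add: Abs_entry_inverse)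
      have "vec_nth v (Abs_entry e) = vec_nth (F z) (Abs_entry e)" using z(2) by simp
      then show ?thesis using that by (simp add: v_def F_def R)
    qed
    then show ?thesis using z(1) unfolding S_def by blast
  qed
  moreover have "\<delta> > 0" using \<epsilon>(1) cpos by (simp add: \<delta>_def)
  ultimately show ?thesis by blast
qed

section \<open>The irreducible set of nondegenerate nets and the codimension\<close>

definition Sigma_component :: "nat cpoly set set" where
  "Sigma_component = zariski_Grass 3 2 3 closure_of {quad.rowspan (net p) | p. nondegenerate p \<noteq> 0}"

lemma irreducible_Sigma_component: "irreducible_closed (zariski_Grass 3 2 3) Sigma_component"
  unfolding Sigma_component_def
  by (rule quad.irreducible_closed_image[where P = net and I = UNIV and e = nondegenerate and
    ?p0.0 = base])
    (rule polyfuns_net polyfuns_nondegenerate nondegenerate_base net_full_rank, assumption?)+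

lemma Sigma_component_subset: "Sigma_component \<subseteq> zariski_Grass 3 2 3 closure_of Sigma_var 3 2 3 5"
  unfolding Sigma_component_def using net_in_Sigma by (intro closure_of_mono) blast

lemma net_in_Sigma_component:
  assumes "nondegenerate p \<noteq> 0"
  shows "quad.rowspan (net p) \<in> Sigma_component"
proof -
  have "{quad.rowspan (net p) | p. nondegenerate p \<noteq> 0} \<subseteq> topspace (zariski_Grass 3 2 3)"
    using quad.rowspan_in_Grass[OF net_full_rank] by (auto simp: quad.topspace_Grass)
  from closure_of_subset[OF this] show ?thesis using assms unfolding Sigma_component_def by blast
qed

lemma missing_entry: "(0, qm 0 1) \<in> quad.free_entries"
  unfolding quad.free_entries_def by (auto simp: pivots_def qm_eq_iff qm_in_monoms)

text \<open>Near \<open>net base\<close> any values of the other 20 free coordinates occur for a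
  nondegenerate net; \<open>f\<close> does not see the coordinate that cannot be prescribed, so it
  vanishes on a box.\<close>

lemma Sigma_component_dominant:
  assumes f: "f \<in> polyfuns (quad.free_entries - {(0, qm 0 1)})"
    and 0: "\<And>x. quad.rowspan (quad.chart x) \<in> Sigma_component \<Longrightarrow> f x = 0"
  shows "f x = 0"
proof -
  let ?t = "(0, qm 0 1) :: nat \<times> nat monom"
  note t = missing_entry
  have sub: "quad.free_entries \<subseteq> quad.entries"
    by (auto simp: quad.free_entries_def quad.entries_def)
  obtain \<epsilon> where \<epsilon>: "\<epsilon> > 0" "\<And>y. (\<And>e. e \<in> quad.entries \<Longrightarrow> norm (y e - net base e) < \<epsilon>) \<Longrightarrow>
      \<exists>p. nondegenerate p \<noteq> 0 \<and> (\<forall>e\<in>quad.entries - {?t}. net p e = y e)"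
    using net_locally_surjective by blast
  have fin: "finite (quad.free_entries - {?t})"
    by (simp add: quad.free_entries_def finite_monoms)
  show ?thesis
  proof (rule polyfuns_eq_0_box[OF f fin \<epsilon>(1)])
    fix x assume x: "\<And>e. e \<in> quad.free_entries - {?t} \<Longrightarrow> norm (x e - net base e) < \<epsilon>"
    \<comment> \<open>The value at the excluded entry is not prescribed; that of \<open>base\<close>
      keeps \<open>y\<close> within \<epsilon>. In the pivot columns both \<open>y\<close> and
      \<open>net base\<close> are the identity.\<close>
    define y where "y e = (if e = ?t then net base ?t else quad.chart x e)" for e
    have y: "norm (y e - net base e) < \<epsilon>" if e: "e \<in> quad.entries" for e
    proof (cases "e \<in> quad.free_entries")
      case True
      then have "quad.chart x e = x e" by (auto simp: quad.chart_def quad.free_entries_def)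
      then show ?thesis using x[of e] True \<epsilon>(1) by (auto simp: y_def)
    next
      case False
      obtain k m where km: "e = (k, m)" "k < 3" "m \<in> set pivots"
        using e False by (auto simp: quad.entries_def quad.free_entries_def)
      obtain j where j: "j < 3" "m = pivots ! j"
        using km(3) quad.length_pv by (auto simp: in_set_conv_nth)
      have "quad.chart x e = (if k = j then 1 else 0)"
        using km j by (auto simp: quad.chart_def pivots_nth qm_eq_iff)
      moreover have "net base e = (if k = j then 1 else 0)"
        using km j by (simp add: pivots_nth net_base_pivot)
      moreover have "e \<noteq> ?t" using False t by blast
      ultimately show ?thesis using \<epsilon>(1) by (simp add: y_def)
    qed
    obtain p where p: "nondegenerate p \<noteq> 0" "\<forall>e\<in>quad.entries - {?t}. net p e = y e"
      using \<epsilon>(2)[OF y] by blast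
    \<comment> \<open>The net dictates the excluded coordinate; with it, \<open>x'\<close> gives the
      chart coordinates of the net.\<close>
    define x' where "x' = x(?t := net p ?t)"
    have "quad.chart x' e = net p e" if e: "e \<in> quad.entries" for e
    proof (cases "e = ?t")
      case True
      then show ?thesis using t by (simp add: quad.chart_def quad.free_entries_def x'_def)
    next
      case False
      then have "quad.chart x' e = quad.chart x e" by (cases e) (auto simp: quad.chart_def x'_def)
      then show ?thesis using p(2) e False by (simp add: y_def)
    qed
    then have "quad.row_forms (quad.chart x') = quad.row_forms (net p)" by (rule
      quad.row_forms_cong)
    then have "f x' = 0" using net_in_Sigma_component[OF p(1)] by (intro 0) simp
    moreover have "f x' = f x" by (rule polyfuns_cong[OF f]) (simp add: x'_def)
    ultimately show "f x = 0" by simp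
  qed
qed

text \<open>In a longer chain the second member would already be the whole Grassmannian, leaving no
  room for a third.\<close>

lemma irreducible_codim_Sigma_component:
  "irreducible_codim (zariski_Grass 3 2 3) Sigma_component \<le> 1"
  unfolding irreducible_codim_def
proof (rule SUP_least)
  fix k assume "k \<in> {k. \<exists>C. irreducible_chain (zariski_Grass 3 2 3) Sigma_component k C}"
  then obtain C where C: "C 0 = Sigma_component" "\<forall>i\<le>k. irreducible_closed (zariski_Grass 3 2 3)
    (C i)"
    "\<forall>i<k. C i \<subset> C (Suc i)" by (auto simp: irreducible_chain_def)
  have "k \<le> 1"
  proof (rule ccontr)
    assume "\<not> k \<le> 1"
    then have k: "0 < k" "1 < k" "1 \<le> k" "2 \<le> k" by auto
    have "C 1 = Grass 3 2 3"
    proof (rule quad.irreducible_above_hypersurface[OF _ _ _ missing_entry])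
      show "closedin (zariski_Grass 3 2 3) Sigma_component"
        using irreducible_Sigma_component by (simp add: irreducible_closed_def)
      show "Sigma_component \<subset> C 1" using C(1,3) k(1) by auto
      show "irreducible_closed (zariski_Grass 3 2 3) (C 1)" using C(2) k(3) by blast
    qed (rule Sigma_component_dominant)
    moreover have "C 1 \<subset> C 2" using C(3) k(2) by (metis Suc_1)
    moreover have "C 2 \<subseteq> Grass 3 2 3"
      using C(2) k(4) quad.closedin_subset_Grass by (auto simp: irreducible_closed_def)
    ultimately show False by blast
  qed
  then show "enat k \<le> 1" by (simp add: one_enat_def)
qed

theorem theorem4p3:
  shows "codim (zariski_Grass 3 2 3) (zariski_Grass 3 2 3 closure_of Sigma_var 3 2 3 5) = 1
    \<and> N1 3 3 5 = 21 \<and> N2 3 2 3 = 21"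
proof (intro conjI antisym)
  let ?X = "zariski_Grass 3 2 3" and ?Y = "zariski_Grass 3 2 3 closure_of Sigma_var 3 2 3 5"
  show "codim ?X ?Y \<le> 1"
  proof -
    have "codim ?X ?Y \<le> irreducible_codim ?X Sigma_component"
      unfolding codim_def
      by (rule INF_lower) (simp add: irreducible_Sigma_component Sigma_component_subset)
    then show ?thesis using irreducible_codim_Sigma_component by (rule order_trans)
  qed
  show "1 \<le> codim ?X ?Y"
    unfolding codim_def
  proof (rule INF_greatest)
    fix Z assume "Z \<in> {Z. irreducible_closed ?X Z \<and> Z \<subseteq> ?Y}"
    then have Z: "irreducible_closed ?X Z" "Z \<subseteq> ?Y" by auto
    have "?Y \<subset> Grass 3 2 3"
      using closure_Sigma_ne_Grass closure_of_subset_topspace[of ?X "Sigma_var 3 2 3 5"]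
        quad.topspace_Grass by blast
    \<comment> \<open>Every irreducible closed subset of the closure has the whole Grassmannian
      strictly above it.\<close>
    then have "irreducible_chain ?X Z 1 (\<lambda>i. if i = 0 then Z else Grass 3 2 3)"
      using Z quad.irreducible_closed_Grass by (auto simp: irreducible_chain_def)
    then have "enat 1 \<le> irreducible_codim ?X Z"
      unfolding irreducible_codim_def by (intro SUP_upper) blast
    then show "1 \<le> irreducible_codim ?X Z" by (simp add: one_enat_def)
  qed
qed (simp_all add: N1_def N2_def eval_nat_numeral)

end
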